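(* Let $p=p_n$ and $k=k_n$ be positive integers with $k\le p$, $p/n\to\infty$, and $(1-k/p)\,n\to\tau\in(0,\infty)$ as $n\to\infty$. Let $\mu_n=\mathrm{Unif}(\mathcal{H}\cap\mathbb{S}^{p-1})$ for a $k$-dimensional linear subspace $\mathcal{H}\subset\mathbb{R}^p$. Let $X,Y$ be two i.i.d. random points on $\mathbb{S}^{p-1}$ (drawn from the measure indicated by the subscript of $\mathbb{P}$). Then $$n\Big[\mathbb{P}_{\mu_n}\big(\sqrt p\,X^\top Y\le u\big)-\mathbb{P}_{\mu_0}\big(\sqrt p\,X^\top Y\le u\big)\Big]\to\frac{-\tau}{2}\cdot\frac{u\exp(-u^2/2)}{\sqrt{2\pi}}$$ as $n\to\infty$, uniformly in $u\in\mathbb{R}$. In particular, $$n\cdot d(\mu_n,\mu_0)\to\frac{\tau}{2\sqrt{2e\pi}} .$$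
   Context: $\mathbb{S}^{p-1}=\{x\in\mathbb{R}^p:\|x\|_2=1\}$ and $\mu_0$ is the uniform distribution on it; $\mathrm{Unif}(\mathcal{H}\cap\mathbb{S}^{p-1})$ is the uniform (rotation-invariant) distribution on the unit sphere of the subspace $\mathcal{H}$. For probability measures $\mu,\nu$ on $\mathbb{S}^{p-1}$, $$d(\mu,\nu)=\sup_{t\in[-1,1]}\big|\mathbb{P}_\mu(X_1^\top Y_1\le t)-\mathbb{P}_\nu(X^\top Y\le t)\big|,$$ where $X_1,Y_1$ are drawn independently from $\mu$ and $X,Y$ independently from $\nu$. *)

theory Defs
  imports "HOL-Probability.Probability" "HOL-Library.Function_Algebras"
begin

instantiation "fun" :: (type, real_vector) real_vector
begin

definition scaleR_fun :: "real \<Rightarrow> ('a \<Rightarrow> 'b) \<Rightarrow> 'a \<Rightarrow> 'b" where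
  "scaleR_fun c f = (\<lambda>x. c *\<^sub>R f x)"

instance
  by standard (simp_all add: scaleR_fun_def plus_fun_def fun_eq_iff scaleR_add_right scaleR_add_left)

end

text \<open>
  Since the dimension varies along a sequence, \<open>\<real>\<^sup>p\<close> is realised as the linear subspace of
  \<open>nat \<Rightarrow> real\<close> of vectors supported on the coordinates \<open>0, \<dots>, p - 1\<close>. The pointwise vector space
  structure above makes the library's \<^const>\<open>subspace\<close>, \<^const>\<open>dim\<close> and \<^const>\<open>linear\<close> available.
  The Borel sets of \<open>nat \<Rightarrow> real\<close> are those of the product topology, whose trace on \<open>\<real>\<^sup>p\<close> is the
  Euclidean topology.
\<close>

definition coord_space :: "nat \<Rightarrow> (nat \<Rightarrow> real) set" where
  "coord_space p = {x. \<forall>i\<ge>p. x i = 0}"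

definition dot :: "nat \<Rightarrow> (nat \<Rightarrow> real) \<Rightarrow> (nat \<Rightarrow> real) \<Rightarrow> real" where
  "dot p x y = (\<Sum>i<p. x i * y i)"

definition unit_sphere :: "nat \<Rightarrow> (nat \<Rightarrow> real) set" where
  "unit_sphere p = {x \<in> coord_space p. L2_set x {..<p} = 1}"

definition sphere_borel :: "nat \<Rightarrow> (nat \<Rightarrow> real) measure" where
  "sphere_borel p = restrict_space borel (unit_sphere p)"

text \<open>
  Orthogonal transformations of \<open>\<real>\<^sup>p\<close>. Only the values of \<open>T\<close> on \<^term>\<open>coord_space p\<close> matter; as
  every linear map on a subspace extends to the whole space, asking for \<^term>\<open>linear T\<close> is no
  restriction.
\<close>

definition orthogonal_on :: "nat \<Rightarrow> ((nat \<Rightarrow> real) \<Rightarrow> nat \<Rightarrow> real) \<Rightarrow> bool" where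
  "orthogonal_on p T \<longleftrightarrow> linear T \<and> T ` coord_space p \<subseteq> coord_space p \<and>
     (\<forall>x\<in>coord_space p. \<forall>y\<in>coord_space p. dot p (T x) (T y) = dot p x y)"

text \<open>
  \<open>uniform_on_sphere p H \<mu>\<close>: \<open>\<mu>\<close> is the rotation-invariant probability measure on the unit sphere
  of the subspace \<open>H\<close>, regarded as a Borel measure on the unit sphere of \<open>\<real>\<^sup>p\<close>. The rotations of
  \<open>H\<close> are the restrictions to \<open>H\<close> of the orthogonal transformations of \<open>\<real>\<^sup>p\<close> that map \<open>H\<close> onto
  itself. They include those of determinant \<open>-1\<close>; this matters only if \<open>H\<close> is a line, where it
  makes the two unit vectors equally likely. For \<open>H \<noteq> {0}\<close> there is exactly one such measure.
\<close>

definition uniform_on_sphere ::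
    "nat \<Rightarrow> (nat \<Rightarrow> real) set \<Rightarrow> (nat \<Rightarrow> real) measure \<Rightarrow> bool" where
  "uniform_on_sphere p H \<mu> \<longleftrightarrow>
     prob_space \<mu> \<and> sets \<mu> = sets (sphere_borel p) \<and>
     (AE x in \<mu>. x \<in> H) \<and>
     (\<forall>T. orthogonal_on p T \<and> T ` H = H \<longrightarrow> distr \<mu> \<mu> T = \<mu>)"

definition sphere_dist :: "nat \<Rightarrow> (nat \<Rightarrow> real) measure \<Rightarrow> (nat \<Rightarrow> real) measure \<Rightarrow> real" where
  "sphere_dist p \<mu> \<nu> =
     (SUP t\<in>{-1..1}. \<bar>\<P>(z in \<mu> \<Otimes>\<^sub>M \<mu>. dot p (fst z) (snd z) \<le> t)
                      - \<P>(z in \<nu> \<Otimes>\<^sub>M \<nu>. dot p (fst z) (snd z) \<le> t)\<bar>)"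

end

theory Submission
  imports Defs "HOL-Real_Asymp.Real_Asymp"
begin

text \<open>
  Reflections of \<open>H\<close> act transitively on its unit sphere, so for unit vectors \<open>y\<close> the moments of
  \<open>X\<^sup>T y\<close> do not depend on \<open>y\<close>, and comparing the moments along \<open>e\<close> and \<open>e + s b\<close> gives a
  recursion that determines them all. Hence \<open>X\<^sup>T Y\<close> has the density proportional to
  \<open>(1 - t\<^sup>2)\<close> to the power \<open>(k - 3) / 2\<close> on \<open>[-1, 1]\<close>.

  With the substitution \<open>v = t \<surd>p\<close>, the weights for \<open>k\<close> and \<open>p\<close> both tend to \<open>exp (- v\<^sup>2 / 2)\<close>,
  while \<open>n\<close> times their difference tends to \<open>\<tau> v\<^sup>2 / 2 * exp (- v\<^sup>2 / 2)\<close>, dominated by a multiple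
  of \<open>v\<^sup>2 exp (- v\<^sup>2 / 4)\<close>. After normalisation, \<open>n\<close> times the difference of the densities converges
  in \<open>L\<^sup>1\<close> to \<open>\<tau> / 2\<close> times \<open>(v\<^sup>2 - 1) \<phi>(v)\<close>, the derivative of \<open>- v \<phi>(v)\<close>. Convergence in \<open>L\<^sup>1\<close>
  makes the convergence of the distribution functions uniform.
\<close>

section \<open>Orthonormal bases\<close>

lemma dot_commute: "dot p x y = dot p y x"
  by (simp add: dot_def mult.commute)

lemma dot_add_left: "dot p (x + y) z = dot p x z + dot p y z"
  by (simp add: dot_def plus_fun_def algebra_simps sum.distrib)

lemma dot_scaleR_left: "dot p (c *\<^sub>R x) z = c * dot p x z"
  by (simp add: dot_def scaleR_fun_def sum_distrib_left mult.assoc)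

lemma dot_add_right: "dot p z (x + y) = dot p z x + dot p z y"
  by (metis dot_add_left dot_commute)

lemma dot_scaleR_right: "dot p z (c *\<^sub>R x) = c * dot p z x"
  by (metis dot_scaleR_left dot_commute)

lemma dot_zero_left [simp]: "dot p 0 z = 0"
  using dot_scaleR_left[of p 0 0 z] by simp

lemma dot_zero_right [simp]: "dot p z 0 = 0"
  by (metis dot_commute dot_zero_left)

lemma dot_diff_left: "dot p (x - y) z = dot p x z - dot p y z"
  using dot_add_left[of p "x - y" y z] by simp

lemma dot_diff_right: "dot p z (x - y) = dot p z x - dot p z y"
  by (metis dot_diff_left dot_commute)

lemma dot_minus_right: "dot p z (- x) = - dot p z x"
  using dot_diff_right[of p z 0 x] by simp

lemma dot_sum_left: "dot p (sum f A) z = (\<Sum>a\<in>A. dot p (f a) z)"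
proof (induction A rule: infinite_finite_induct)
  case (infinite A)
  then show ?case by (simp only: sum.infinite dot_zero_left not_False_eq_True)
next
  case (insert a A)
  then show ?case by (metis dot_add_left sum.insert)
qed (simp only: sum.empty dot_zero_left)

lemma dot_sum_right: "dot p z (sum f A) = (\<Sum>a\<in>A. dot p z (f a))"
  by (simp only: dot_commute[of p z] dot_sum_left)

lemmas dot_simps = dot_add_left dot_add_right dot_scaleR_left dot_scaleR_right
  dot_diff_left dot_diff_right dot_minus_right

lemma dot_self_nonneg [simp]: "0 \<le> dot p x x"
  by (simp add: dot_def sum_nonneg)

lemma dot_self_eq_0_iff:
  assumes "x \<in> coord_space p"
  shows "dot p x x = 0 \<longleftrightarrow> x = 0"
proof
  assume "dot p x x = 0"
  then have "\<forall>i<p. x i = 0"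
    by (simp add: dot_def sum_nonneg_eq_0_iff)
  then have "x i = 0" for i
    using assms by (cases "i < p") (auto simp: coord_space_def)
  then show "x = 0" by (simp add: fun_eq_iff)
qed simp

lemma subspace_coord_space: "subspace (coord_space p)"
  by (rule subspaceI) (simp_all add: coord_space_def scaleR_fun_def)

lemma unit_sphere_eq: "unit_sphere p = {x \<in> coord_space p. dot p x x = 1}"
proof -
  have "L2_set x {..<p} = 1 \<longleftrightarrow> dot p x x = 1" for x
    by (simp only: L2_set_def real_sqrt_eq_1_iff dot_def power2_eq_square)
  then show ?thesis by (auto simp: unit_sphere_def)
qed

definition orthonormal :: "nat \<Rightarrow> (nat \<Rightarrow> real) set \<Rightarrow> bool" where
  "orthonormal p B \<longleftrightarrow> finite B \<and> B \<subseteq> coord_space p \<and>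
     (\<forall>b\<in>B. \<forall>c\<in>B. dot p b c = (if b = c then 1 else 0))"

text \<open>The identity is linear in \<open>x\<close>, so induction on the span reduces it to
  elements of \<open>B\<close>, where orthonormality leaves a single term.\<close>

lemma orthonormal_expansion:
  assumes "orthonormal p B" "x \<in> span B"
  shows "x = (\<Sum>b\<in>B. dot p x b *\<^sub>R b)"
  using assms(2)
proof (induction rule: span_induct)
  case base
  show ?case
  proof (rule subspaceI)
    fix c x
    assume "x \<in> {x. x = (\<Sum>b\<in>B. dot p x b *\<^sub>R b)}"
    then have "c *\<^sub>R x = c *\<^sub>R (\<Sum>b\<in>B. dot p x b *\<^sub>R b)" by simp
    also have "\<dots> = (\<Sum>b\<in>B. dot p (c *\<^sub>R x) b *\<^sub>R b)"
      by (simp only: scaleR_sum_right dot_scaleR_left scaleR_scaleR)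
    finally show "c *\<^sub>R x \<in> {x. x = (\<Sum>b\<in>B. dot p x b *\<^sub>R b)}" by simp
  qed (simp_all add: dot_simps scaleR_add_left sum.distrib)
next
  case (step b)
  have "(\<Sum>c\<in>B. dot p b c *\<^sub>R c) = (\<Sum>c\<in>B. if c = b then c else 0)"
    using assms(1) step by (intro sum.cong) (auto simp: orthonormal_def)
  also have "\<dots> = b"
    using assms(1) step by (simp add: orthonormal_def)
  finally show ?case by simp
qed

lemma orthonormal_parseval:
  assumes "orthonormal p B" "x \<in> span B"
  shows "dot p x x = (\<Sum>b\<in>B. (dot p x b)\<^sup>2)"
proof -
  have "dot p x x = dot p x (\<Sum>b\<in>B. dot p x b *\<^sub>R b)"
    using orthonormal_expansion[OF assms] by simp
  then show ?thesis
    by (simp add: dot_sum_right dot_scaleR_right power2_eq_square)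
qed

lemma orthonormal_independent:
  assumes "orthonormal p B"
  shows "independent B"
proof (rule independent_if_scalars_zero)
  show "finite B" using assms by (simp add: orthonormal_def)
next
  fix f b
  assume 0: "(\<Sum>c\<in>B. f c *\<^sub>R c) = 0" and b: "b \<in> B"
  have "0 = dot p (\<Sum>c\<in>B. f c *\<^sub>R c) b" using 0 by simp
  also have "\<dots> = (\<Sum>c\<in>B. f c * dot p c b)"
    by (simp add: dot_sum_left dot_scaleR_left)
  also have "\<dots> = (\<Sum>c\<in>B. if c = b then f c else 0)"
    using assms b by (intro sum.cong) (auto simp: orthonormal_def)
  also have "\<dots> = f b" using assms b by (simp add: orthonormal_def)
  finally show "f b = 0" by simp
qed

lemma gram_schmidt:
  assumes "finite C" "C \<subseteq> coord_space p"
  shows "\<exists>B. orthonormal p B \<and> span B = span C"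
  using assms
proof (induction C rule: finite_induct)
  case empty
  then show ?case by (intro exI[of _ "{}"]) (simp add: orthonormal_def)
next
  case (insert c C)
  then obtain B where B: "orthonormal p B" "span B = span C" by auto
  have fin: "finite B" and BH: "B \<subseteq> coord_space p"
    and on: "\<And>b d. b \<in> B \<Longrightarrow> d \<in> B \<Longrightarrow> dot p b d = (if b =
        d then 1 else 0)"
    using B(1) by (auto simp: orthonormal_def)
  \<comment> \<open>\<open>r\<close> is the component of \<open>c\<close> orthogonal to
    \<open>span B\<close>. If it vanishes, \<open>c\<close> does not enlarge the span; otherwise its
    normalisation \<open>e\<close> is the new basis vector.\<close>
  define r where "r = c - (\<Sum>b\<in>B. dot p c b *\<^sub>R b)"
  have sum_span: "(\<Sum>b\<in>B. dot p c b *\<^sub>R b) \<in> span B"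
    by (intro span_sum span_scale span_base)
  show ?case
  proof (cases "r = 0")
    case True
    then have "c \<in> span B" using sum_span by (simp add: r_def)
    then have "span (insert c C) = span C" using B(2) by (simp add: span_redundant)
    then show ?thesis using B by blast
  next
    case False
    have "span B \<subseteq> coord_space p"
      using BH subspace_coord_space by (rule span_minimal)
    then have r: "r \<in> coord_space p"
      using insert.prems sum_span subspace_coord_space
      unfolding r_def by (auto intro: subspace_diff)
    then have pos: "0 < dot p r r"
      using False dot_self_eq_0_iff[OF r] dot_self_nonneg[of p r] by linarith
    have rb: "dot p r b = 0" if "b \<in> B" for b
    proof -
      have "(\<Sum>d\<in>B. dot p c d * dot p d b) = (\<Sum>d\<in>B. if d = b then dot p c d else 0)"
        using that on by (intro sum.cong) auto
      also have "\<dots> = dot p c b" using that fin by simp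
      finally show ?thesis
        by (simp add: r_def dot_diff_left dot_sum_left dot_scaleR_left)
    qed
    define e where "e = (1 / sqrt (dot p r r)) *\<^sub>R r"
    have ee: "dot p e e = 1"
      using pos by (simp add: e_def dot_simps)
    have eb: "dot p e b = 0" "dot p b e = 0" if "b \<in> B" for b
      using rb[OF that] by (simp_all add: e_def dot_simps dot_commute[of p b])
    have eH: "e \<in> coord_space p"
      unfolding e_def using r subspace_coord_space by (rule subspace_scale[rotated])
    have "orthonormal p (insert e B)"
    proof -
      have "e \<notin> B" using ee eb(1)[of e] by auto
      then have "dot p b d = (if b = d then 1 else 0)" if "b \<in> insert e B" "d \<in> insert e B" for b d
        using that ee eb(1)[of d] eb(2)[of b] on[of b d] by (elim insertE) auto
      then show ?thesis using fin BH eH by (simp add: orthonormal_def)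
    qed
    moreover have "span (insert e B) = span (insert c C)"
    proof -
      have e1: "e \<in> span (insert c B)"
      proof -
        have "(\<Sum>b\<in>B. dot p c b *\<^sub>R b) \<in> span (insert c B)"
          using sum_span span_mono[of B "insert c B"] by blast
        then show ?thesis
          unfolding e_def r_def by (intro span_scale span_diff) (auto intro: span_base)
      qed
      have c1: "c \<in> span (insert e B)"
      proof -
        have "(\<Sum>b\<in>B. dot p c b *\<^sub>R b) \<in> span (insert e B)"
          using sum_span span_mono[of B "insert e B"] by blast
        then have "sqrt (dot p r r) *\<^sub>R e + (\<Sum>b\<in>B. dot p c b *\<^sub>R b) \<in> span (insert e B)"
          by (intro span_add span_scale) (auto intro: span_base)
        moreover have "sqrt (dot p r r) *\<^sub>R e + (\<Sum>b\<in>B. dot p c b *\<^sub>R b) = c"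
          using pos by (simp add: e_def) (simp add: r_def)
        ultimately show ?thesis by (simp only:)
      qed
      have "span (insert e B) = span (insert c B)"
      proof (rule subset_antisym; rule span_minimal)
        show "insert e B \<subseteq> span (insert c B)"
          using e1 by (auto intro: span_base)
        show "insert c B \<subseteq> span (insert e B)"
          using c1 by (auto intro: span_base)
      qed (rule subspace_span)+
      also have "\<dots> = span (insert c C)"
        using B(2) unfolding span_insert by simp
      finally show ?thesis .
    qed
    ultimately show ?thesis by blast
  qed
qed

lemma orthonormal_basis_exists:
  assumes "subspace H" "H \<subseteq> coord_space p" "dim H \<ge> 1"
  obtains B where "orthonormal p B" "span B = H" "card B = dim H"
proof -
  obtain C where C: "C \<subseteq> H" "independent C" "H \<subseteq> span C" "card C = dim H"
    using basis_exists by blast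
  \<comment> \<open>An infinite set has \<open>card\<close> equal to 0, so positive dimension forces
    \<open>C\<close> to be finite.\<close>
  then have "finite C" using assms(3) by (intro card_ge_0_finite) simp
  then obtain B where B: "orthonormal p B" "span B = span C"
    using gram_schmidt[of C p] C(1) assms(2) by auto
  have "span C = H" using C span_minimal[OF C(1) assms(1)] by blast
  moreover have "card B = dim H"
    using dim_eq_card[OF B(2) orthonormal_independent[OF B(1)]] C(4)
      dim_eq_card[OF refl C(2)] by simp
  ultimately show ?thesis using that B by blast
qed

lemma sum_fun_apply: "(sum f A :: 'b \<Rightarrow> real) x = (\<Sum>a\<in>A. f a x)"
proof (induction A rule: infinite_finite_induct)
  case (infinite A)
  then show ?case by (simp only: sum.infinite not_False_eq_True zero_fun_apply)
next
  case (insert a A)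
  then show ?case by (metis plus_fun_apply sum.insert)
qed (simp only: sum.empty zero_fun_apply)

text \<open>The coordinate vectors form an orthonormal basis. This lets the full sphere be treated
  as the case \<open>H = coord_space p\<close>, in dimension \<open>p\<close>.\<close>

lemma dim_coord_space: "dim (coord_space p) = p"
proof -
  define a :: "nat \<Rightarrow> nat \<Rightarrow> real" where "a i j = (if j = i then 1 else 0)"
      for i j
  have "inj_on a {..<p}"
    by (rule inj_onI) (metis a_def zero_neq_one)
  then have card: "card (a ` {..<p}) = p" by (simp add: card_image)
  have dot_a: "dot p x (a i) = x i" if "i < p" for x i
  proof -
    have "dot p x (a i) = (\<Sum>j<p. if j = i then x j else 0)"
      unfolding dot_def by (intro sum.cong) (auto simp: a_def)
    then show ?thesis using that by simp
  qed
  have a_in: "a ` {..<p} \<subseteq> coord_space p"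
    by (auto simp: coord_space_def a_def)
  moreover have "a i = a j \<longleftrightarrow> i = j" for i j
    by (metis a_def zero_neq_one)
  ultimately have on: "orthonormal p (a ` {..<p})"
    unfolding orthonormal_def by (auto simp: dot_a) (simp_all add: a_def)
  have "x \<in> span (a ` {..<p})" if "x \<in> coord_space p" for x
  proof -
    have "x = (\<Sum>i<p. x i *\<^sub>R a i)"
    proof
      fix j
      have "(\<Sum>i<p. x i *\<^sub>R a i) j = (\<Sum>i<p. if i = j then x i else 0)"
        unfolding sum_fun_apply by (intro sum.cong) (auto simp: scaleR_fun_def a_def)
      then show "x j = (\<Sum>i<p. x i *\<^sub>R a i) j"
        using that by (simp add: coord_space_def)
    qed
    moreover have "(\<Sum>i<p. x i *\<^sub>R a i) \<in> span (a ` {..<p})"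
      by (intro span_sum span_scale span_base imageI) simp
    ultimately show ?thesis by metis
  qed
  moreover have "span (a ` {..<p}) \<subseteq> coord_space p"
    using a_in subspace_coord_space by (rule span_minimal)
  ultimately have "span (a ` {..<p}) = coord_space p" by blast
  then have "span (a ` {..<p}) = span (coord_space p)"
    by (metis span_span)
  then show ?thesis
    using dim_eq_card orthonormal_independent[OF on] card by metis
qed

section \<open>Moments of rotation-invariant measures\<close>

definition householder :: "nat \<Rightarrow> (nat \<Rightarrow> real)
    \<Rightarrow> (nat \<Rightarrow> real) \<Rightarrow> nat \<Rightarrow> real" where
  "householder p w x = x - (2 * dot p x w / dot p w w) *\<^sub>R w"

lemma linear_householder: "linear (householder p w)"
  by (rule linearI)
    (simp_all add: householder_def dot_simps algebra_simps add_divide_distrib del: plus_fun_apply)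

lemma householder_in_subspace:
  assumes "subspace H" "w \<in> H" "x \<in> H"
  shows "householder p w x \<in> H"
  unfolding householder_def using assms by (intro subspace_diff subspace_scale)

text \<open>A reflection is self-adjoint; being also an involution, it preserves
  \<open>dot\<close>.\<close>

lemma dot_householder: "dot p (householder p w x) y = dot p x (householder p w y)"
  by (simp add: householder_def dot_simps dot_commute[of p w y])

lemma householder_involution: "householder p w (householder p w x) = x"
proof (cases "dot p w w = 0")
  \<comment> \<open>Division by zero yields the coefficient 0 here, so the reflection degenerates to
    the identity.\<close>
  case True
  then show ?thesis by (simp add: householder_def)
next
  case False
  then have "2 * dot p (householder p w x) w / dot p w w = - (2 * dot p x w / dot p w w)"
    by (simp add: householder_def dot_simps)
  then show ?thesis
    by (simp add: householder_def[of p w "householder p w x"]) (simp add: householder_def)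
qed

lemma householder_image:
  assumes "subspace H" "w \<in> H"
  shows "householder p w ` H = H"
proof
  show "householder p w ` H \<subseteq> H"
    using householder_in_subspace[OF assms] by blast
  show "H \<subseteq> householder p w ` H"
  proof
    fix x assume "x \<in> H"
    then have "householder p w x \<in> H" by (rule householder_in_subspace[OF assms])
    then show "x \<in> householder p w ` H"
      using householder_involution[of p w x] by (metis imageI)
  qed
qed

lemma orthogonal_on_householder:
  assumes "w \<in> coord_space p"
  shows "orthogonal_on p (householder p w)"
  unfolding orthogonal_on_def
  using linear_householder householder_image[OF subspace_coord_space assms]
  by (auto simp: dot_householder householder_involution)

text \<open>The vector \<open>y - z\<close> is normal to the hyperplane bisecting the segment from
  \<open>z\<close> to \<open>y\<close>. Equal lengths make that hyperplane pass through the origin,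
  so the reflection carries \<open>z\<close> to \<open>y\<close>. This is the source of transitivity
  on the unit sphere of \<open>H\<close>.\<close>

lemma householder_swaps:
  assumes "y \<in> coord_space p" "z \<in> coord_space p" "dot p y y = dot p z z"
  shows "householder p (y - z) z = y"
proof -
  have w: "y - z \<in> coord_space p"
    using assms subspace_coord_space by (auto intro: subspace_diff)
  have eq: "dot p (y - z) (y - z) = - 2 * dot p z (y - z)"
    using assms(3) by (simp add: dot_simps dot_commute[of p y z])
  show ?thesis
  proof (cases "dot p (y - z) (y - z) = 0")
    case True
    then have "y - z = 0" using dot_self_eq_0_iff[OF w] by simp
    then show ?thesis by (simp add: householder_def)
  next
    case False
    then have "2 * dot p z (y - z) / dot p (y - z) (y - z) = - 1"
      using eq by (simp add: field_simps)
    then show ?thesis by (simp add: householder_def)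
  qed
qed

lemma abs_dot_le_unit_sphere:
  assumes "x \<in> unit_sphere p"
  shows "\<bar>dot p x y\<bar> \<le> L2_set y {..<p}"
proof -
  have "\<bar>dot p x y\<bar> \<le> (\<Sum>i<p. \<bar>x i\<bar> * \<bar>y i\<bar>)"
    unfolding dot_def by (rule order_trans[OF sum_abs]) (simp add: abs_mult)
  also have "\<dots> \<le> L2_set x {..<p} * L2_set y {..<p}"
    by (rule L2_set_mult_ineq)
  finally show ?thesis using assms by (simp add: unit_sphere_def)
qed

text \<open>Pads a polynomial in \<open>s\<^sup>2\<close> with zero odd coefficients, so that it can
  be compared with a binomial expansion in powers of \<open>s\<close>.\<close>

lemma sum_atMost_double:
  fixes f :: "nat \<Rightarrow> real"
  shows "(\<Sum>i\<le>2 * j. if even i then f (i div 2) else 0) = (\<Sum>i\<le>j. f i)"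
proof (induction j)
  case (Suc j)
  have "(\<Sum>i\<le>2 * Suc j. if even i then f (i div 2) else 0) =
    (\<Sum>i\<le>2 * j. if even i then f (i div 2) else 0) + f (Suc j)"
    by simp
  then show ?case using Suc by simp
qed simp

section \<open>Consequences of rotation invariance for one-dimensional projections\<close>

locale uniform_sphere =
  fixes p :: nat and H :: "(nat \<Rightarrow> real) set" and \<mu> :: "(nat \<Rightarrow> real) measure"
  assumes uniform: "uniform_on_sphere p H \<mu>"
    and subspace_H: "subspace H"
    and H_subset: "H \<subseteq> coord_space p"
begin

sublocale prob_space \<mu>
  using uniform by (simp add: uniform_on_sphere_def)

lemma sets_eq: "sets \<mu> = sets (sphere_borel p)"
  using uniform by (simp add: uniform_on_sphere_def)

lemma space_eq: "space \<mu> = unit_sphere p"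
  using sets_eq_imp_space_eq[OF sets_eq] by (simp add: sphere_borel_def space_restrict_space)

lemma AE_in_H: "AE x in \<mu>. x \<in> H"
  using uniform by (simp add: uniform_on_sphere_def)

lemma measurable_coord [measurable]: "(\<lambda>x. x i) \<in> borel_measurable \<mu>"
  unfolding measurable_cong_sets[OF sets_eq refl] sphere_borel_def
  by (intro measurable_restrict_space1 measurable_product_coordinates)

lemma measurable_dot [measurable]: "(\<lambda>x. dot p x y) \<in> borel_measurable \<mu>"
  unfolding dot_def by measurable

lemma measurable_dot_pair [measurable]:
  "(\<lambda>z. dot p (fst z) (snd z)) \<in> borel_measurable (\<mu> \<Otimes>\<^sub>M \<mu>)"
  unfolding dot_def by measurable

lemma measurable_householder:
  assumes "w \<in> coord_space p"
  shows "householder p w \<in> measurable \<mu> \<mu>"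
proof -
  have "householder p w \<in> borel_measurable \<mu>"
  proof (rule measurable_coordinatewise_then_product)
    fix i
    have "(\<lambda>x. householder p w x i) = (\<lambda>x. x i - 2 * dot p x w / dot p w w * w i)"
      by (simp add: householder_def scaleR_fun_def fun_eq_iff)
    then show "(\<lambda>x. householder p w x i) \<in> borel_measurable \<mu>" by simp
  qed
  moreover have "householder p w x \<in> unit_sphere p" if "x \<in> unit_sphere p" for x
    using that householder_in_subspace[OF subspace_coord_space assms]
    by (auto simp: unit_sphere_eq dot_householder householder_involution)
  ultimately have "householder p w \<in> measurable \<mu> (sphere_borel p)"
    unfolding sphere_borel_def by (intro measurable_restrict_space2) (auto simp: space_eq)
  then show ?thesis
    using measurable_cong_sets[OF refl sets_eq, of \<mu>] by blast
qed

text \<open>The reflection along \<open>y - z\<close> preserves both \<open>H\<close> and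
  \<open>\<mu>\<close>. Self-adjointness moves it from the random point onto \<open>z\<close>, which
  it sends to \<open>y\<close>.\<close>

lemma integral_dot_cong:
  fixes f :: "real \<Rightarrow> real"
  assumes "y \<in> H" "z \<in> H" "dot p y y = dot p z z" and f: "f \<in> borel_measurable borel"
  shows "(\<integral>x. f (dot p x y) \<partial>\<mu>) = (\<integral>x. f (dot p x z) \<partial>\<mu>)"
proof -
  let ?T = "householder p (y - z)"
  have w: "y - z \<in> H" using assms subspace_H by (auto intro: subspace_diff)
  then have w': "y - z \<in> coord_space p" using H_subset by blast
  have "distr \<mu> \<mu> ?T = \<mu>"
    using uniform orthogonal_on_householder[OF w'] householder_image[OF subspace_H w]
    by (simp add: uniform_on_sphere_def)
  then have "(\<integral>x. f (dot p x z) \<partial>\<mu>) = (\<integral>x. f (dot p x z) \<partial>distr \<mu> \<mu> ?T)"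
    by simp
  also have "\<dots> = (\<integral>x. f (dot p (?T x) z) \<partial>\<mu>)"
    by (intro integral_distr measurable_householder w' measurable_compose[OF measurable_dot f])
  also have "\<dots> = (\<integral>x. f (dot p x y) \<partial>\<mu>)"
    using householder_swaps[of y p z] assms H_subset by (simp add: dot_householder subset_iff)
  finally show ?thesis by simp
qed

lemma integrable_dot_powers: "integrable \<mu> (\<lambda>x. dot p x y ^ i * dot p x z ^ j)"
proof (rule integrable_const_bound[of _ "L2_set y {..<p} ^ i * L2_set z {..<p} ^ j"])
  show "AE x in \<mu>. norm (dot p x y ^ i * dot p x z ^ j) \<le> L2_set y {..<p} ^ i * L2_set z {..<p} ^ j"
    by (rule AE_I2)
      (auto simp: space_eq abs_mult power_abs intro!: mult_mono power_mono abs_dot_le_unit_sphere)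
qed measurable

text \<open>The vectors \<open>y\<close> and \<open>- y\<close> have equal length, so an odd moment
  equals its own negative.\<close>

lemma odd_moment_zero:
  assumes "y \<in> H" "odd j"
  shows "(\<integral>x. dot p x y ^ j \<partial>\<mu>) = 0"
proof -
  have "(\<integral>x. dot p x y ^ j \<partial>\<mu>) = (\<integral>x. dot p x (- y) ^ j \<partial>\<mu>)"
  proof (rule integral_dot_cong[where f = "\<lambda>t. t ^ j"])
    show "- y \<in> H" using assms(1) subspace_H by (rule subspace_neg[rotated])
    show "dot p y y = dot p (- y) (- y)"
      by (simp only: dot_minus_right dot_commute[of p "- y"] minus_minus)
  qed (use assms(1) in simp_all)
  also have "\<dots> = - (\<integral>x. dot p x y ^ j \<partial>\<mu>)"
    using assms(2) by (simp add: dot_minus_right)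
  finally show ?thesis by simp
qed

text \<open>The vector \<open>y\<close> has the same length as \<open>c *\<^sub>R e\<close>, where
  \<open>c\<close> is the length of \<open>y\<close>; even powers leave only
  \<open>c\<^sup>2\<close>.\<close>

lemma even_moment_scale:
  assumes "e \<in> H" "dot p e e = 1" "y \<in> H"
  shows "(\<integral>x. dot p x y ^ (2 * j) \<partial>\<mu>) = dot p y y ^ j * (\<integral>x. dot p x e ^ (2 * j) \<partial>\<mu>)"
proof -
  define c where "c = sqrt (dot p y y)"
  have c2: "c\<^sup>2 = dot p y y" by (simp add: c_def)
  have "c *\<^sub>R e \<in> H" using assms(1) subspace_H by (rule subspace_scale[rotated])
  then have "(\<integral>x. dot p x y ^ (2 * j) \<partial>\<mu>) = (\<integral>x. dot p x (c *\<^sub>R e) ^ (2 * j) \<partial>\<mu>)"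
    using assms c2 by (intro integral_dot_cong) (simp_all add: dot_simps power2_eq_square)
  also have "\<dots> = (\<integral>x. dot p y y ^ j * dot p x e ^ (2 * j) \<partial>\<mu>)"
    by (simp add: dot_simps power_mult_distrib power_mult c2)
  finally show ?thesis by simp
qed

text \<open>Compares the coefficients of \<open>s\<^sup>2\<close> in \<open>E (X\<^sub>e + s X\<^sub>b)\<^sup>2\<^sup>j = (1 + s\<^sup>2)\<^sup>j E X\<^sub>e\<^sup>2\<^sup>j\<close>.\<close>
lemma mixed_moment:
  assumes "e \<in> H" "b \<in> H" "dot p e e = 1" "dot p b b = 1" "dot p e b = 0"
  shows "(2 * real j + 1) * (\<integral>x. dot p x e ^ (2 * j) * (dot p x b)\<^sup>2 \<partial>\<mu>) =
    (\<integral>x. dot p x e ^ (2 * Suc j) \<partial>\<mu>)"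
proof -
  let ?J = "Suc j"
  define M where "M = (\<integral>x. dot p x e ^ (2 * ?J) \<partial>\<mu>)"
  define A where "A i = (\<integral>x. dot p x b ^ i * dot p x e ^ (2 * ?J - i) \<partial>\<mu>)" for i
  have "(\<Sum>i\<le>2 * ?J. (real (2 * ?J choose i) * A i) * s ^ i) =
        (\<Sum>i\<le>2 * ?J. (if even i then real (?J choose (i div 2)) * M else 0) * s ^ i)" for s
  proof -
    have "e + s *\<^sub>R b \<in> H"
      using assms subspace_H by (intro subspace_add subspace_scale)
    then have "(\<integral>x. dot p x (e + s *\<^sub>R b) ^ (2 * ?J) \<partial>\<mu>) =
        dot p (e + s *\<^sub>R b) (e + s *\<^sub>R b) ^ ?J * M"
      unfolding M_def by (rule even_moment_scale[OF assms(1,3)])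
    moreover have "dot p (e + s *\<^sub>R b) (e + s *\<^sub>R b) = s\<^sup>2 + 1"
      using assms by (simp add: dot_simps dot_commute[of p b e] power2_eq_square)
    moreover have "(\<integral>x. dot p x (e + s *\<^sub>R b) ^ (2 * ?J) \<partial>\<mu>) =
        (\<integral>x. (\<Sum>i\<le>2 * ?J. real (2 * ?J choose i) * s ^ i * (dot p x b ^ i * dot p x e ^ (2 *
            ?J - i))) \<partial>\<mu>)"
      by (simp only: dot_simps add.commute[of "dot p _ e"] binomial_ring power_mult_distrib mult_ac)
    moreover have "\<dots> = (\<Sum>i\<le>2 * ?J. real (2 * ?J choose i) * s ^ i * A i)"
      unfolding A_def
      by (subst Bochner_Integration.integral_sum)
        (simp_all only: integral_mult_right_zero integrable_mult_right[OF integrable_dot_powers])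
    ultimately have "(\<Sum>i\<le>2 * ?J. real (2 * ?J choose i) * s ^ i * A i) = (s\<^sup>2 + 1) ^ ?J * M"
      by simp
    also have "\<dots> = (\<Sum>i\<le>?J. real (?J choose i) * M * (s\<^sup>2) ^ i)"
      unfolding binomial_ring sum_distrib_right by (simp add: mult_ac del: sum.atMost_Suc)
    also have "\<dots> = (\<Sum>i\<le>2 * ?J. if even i then real (?J choose (i div 2)) * M * (s\<^sup>2)
        ^ (i div 2) else 0)"
      by (rule sum_atMost_double[symmetric])
    also have "\<dots> = (\<Sum>i\<le>2 * ?J. (if even i then real (?J choose (i div 2)) * M else 0) * s ^ i)"
      by (intro sum.cong) (auto simp flip: power_mult)
    finally show ?thesis by (simp add: mult_ac)
  qed
  \<comment> \<open>Polynomials in \<open>s\<close> that agree for every real \<open>s\<close> have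
    equal coefficients. At index 2 the binomial coefficient is \<open>?J * (2 * j + 1)\<close>, and
    the factor \<open>?J\<close> cancels against the other side.\<close>
  then have "\<forall>i\<le>2 * ?J. real (2 * ?J choose i) * A i = (if even i then real (?J choose (i div 2)) *
      M else 0)"
    by (subst polyfun_eq_coeffs[symmetric]) blast
  then have "real (2 * ?J choose 2) * A 2 = real (?J choose 1) * M"
    by (drule_tac x=2 in spec) simp
  moreover have "real (2 * ?J choose 2) = real ?J * (2 * real j + 1)"
  proof -
    have "2 * ?J choose 2 = ?J * (2 * j + 1)"
      by (simp add: choose_two)
    then show ?thesis by (simp only: of_nat_mult) simp
  qed
  ultimately have "real ?J * ((2 * real j + 1) * A 2) = real ?J * M"
    by simp
  then have "(2 * real j + 1) * A 2 = M"
    by (subst (asm) mult_cancel_left) simp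
  then show ?thesis
    by (simp add: A_def M_def mult.commute)
qed

end

locale uniform_sphere_basis = uniform_sphere +
  fixes B :: "(nat \<Rightarrow> real) set"
  assumes basis: "orthonormal p B" "span B = H"
begin

lemma AE_parseval: "AE x in \<mu>. (\<Sum>b\<in>B. (dot p x b)\<^sup>2) = 1"
  using AE_in_H AE_space
proof eventually_elim
  case (elim x)
  then show ?case
    using orthonormal_parseval[OF basis(1), of x] basis(2) by (simp add: space_eq unit_sphere_eq)
qed

lemma basis_facts:
  assumes "e \<in> B"
  shows "e \<in> H" "dot p e e = 1" "finite B"
  using assms basis span_base by (auto simp: orthonormal_def)

lemma AE_abs_dot_le_1:
  assumes "e \<in> B"
  shows "AE x in \<mu>. \<bar>dot p x e\<bar> \<le> 1"
  using AE_parseval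
proof eventually_elim
  case (elim x)
  have "(dot p x e)\<^sup>2 \<le> (\<Sum>b\<in>B. (dot p x b)\<^sup>2)"
    using basis_facts[OF assms] assms by (intro member_le_sum) auto
  then show ?case using elim by (simp add: abs_square_le_1)
qed

text \<open>Multiply the moment of order \<open>2 * j\<close> by the sum of all
  \<open>(dot p x b)\<^sup>2\<close>, which is 1 almost everywhere. The term \<open>b = e\<close> is
  the next even moment, and by \<open>mixed_moment\<close> each of the other
  \<open>card B - 1\<close> terms is that moment divided by \<open>2 * j + 1\<close>.\<close>

lemma even_moment_rec:
  assumes e: "e \<in> B"
  shows "(2 * real j + real (card B)) * (\<integral>x. dot p x e ^ (2 * Suc j) \<partial>\<mu>) =
    (2 * real j + 1) * (\<integral>x. dot p x e ^ (2 * j) \<partial>\<mu>)"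
proof -
  note eB = basis_facts[OF e]
  let ?M = "\<integral>x. dot p x e ^ (2 * Suc j) \<partial>\<mu>"
  have other: "(2 * real j + 1) * (\<integral>x. dot p x e ^ (2 * j) * (dot p x b)\<^sup>2 \<partial>\<mu>) = ?M"
    if "b \<in> B - {e}" for b
    using that eB basis_facts[of b] basis(1) e by (intro mixed_moment) (auto simp: orthonormal_def)
  have "(\<integral>x. dot p x e ^ (2 * j) \<partial>\<mu>) = (\<integral>x. (\<Sum>b\<in>B. dot p x e ^ (2 * j) * (dot p x b)\<^sup>2) \<partial>\<mu>)"
  proof (rule integral_cong_AE)
    show "AE x in \<mu>. dot p x e ^ (2 * j) = (\<Sum>b\<in>B. dot p x e ^ (2 * j) * (dot p x b)\<^sup>2)"
      using AE_parseval by eventually_elim (simp flip: sum_distrib_left)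
  qed measurable
  also have "\<dots> = (\<Sum>b\<in>B. \<integral>x. dot p x e ^ (2 * j) * (dot p x b)\<^sup>2 \<partial>\<mu>)"
    by (intro Bochner_Integration.integral_sum integrable_dot_powers)
  also have "\<dots> = ?M + (\<Sum>b\<in>B - {e}. \<integral>x. dot p x e ^ (2 * j) * (dot p x b)\<^sup>2 \<partial>\<mu>)"
    using eB e by (subst sum.remove[of B e]) (simp_all add: power_add power2_eq_square mult_ac)
  finally have "(2 * real j + 1) * (\<integral>x. dot p x e ^ (2 * j) \<partial>\<mu>) =
    (2 * real j + 1) * ?M + (\<Sum>b\<in>B - {e}. (2 * real j + 1) * (\<integral>x. dot p x e ^ (2 * j) *
        (dot p x b)\<^sup>2 \<partial>\<mu>))"
    by (simp add: distrib_left sum_distrib_left)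
  also have "\<dots> = (2 * real j + 1) * ?M + real (card (B - {e})) * ?M"
    using other by (simp del: mult_Suc_right)
  also have "real (card (B - {e})) = real (card B) - 1"
  proof -
    have "card B \<ge> 1" using eB e by (metis One_nat_def Suc_leI card_gt_0_iff empty_iff)
    then show ?thesis using e by (simp add: card_Diff_singleton of_nat_diff)
  qed
  finally show ?thesis by (simp add: algebra_simps)
qed

end

section \<open>The law of the inner product\<close>

text \<open>On \<open>[-1, 1]\<close> polynomials approximate continuous functions uniformly, so
  equal moments give equal integrals of bounded continuous functions. Applied to sine and cosine
  this identifies the characteristic functions.\<close>

lemma real_distribution_eqI_moments:
  fixes M N :: "real measure"
  assumes M: "real_distribution M" "AE x in M. \<bar>x\<bar> \<le> 1"
    and N: "real_distribution N" "AE x in N. \<bar>x\<bar> \<le> 1"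
    and moments: "\<And>j. (\<integral>x. x ^ j \<partial>M) = (\<integral>x. x ^ j \<partial>N)"
  shows "M = N"
proof -
  interpret M: real_distribution M by (rule M(1))
  interpret N: real_distribution N by (rule N(1))
  have int_pow: "integrable L (\<lambda>x. x ^ j)"
    if "real_distribution L" "AE x in L. \<bar>x\<bar> \<le> 1" for L :: "real measure" and j
  proof -
    interpret L: real_distribution L by (rule that(1))
    show ?thesis
    proof (rule L.integrable_const_bound[of _ 1])
      show "AE x in L. norm (x ^ j) \<le> 1"
        using that(2) by eventually_elim (simp add: power_abs power_le_one)
    qed measurable
  qed
  have eq_cont: "(\<integral>x. f x \<partial>M) = (\<integral>x. f x \<partial>N)"
    if cont: "continuous_on UNIV f" and bdd: "\<And>x. \<bar>f x\<bar> \<le> 1" for f :: "real \<Rightarrow> real"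
  proof (rule ccontr)
    assume neq: "(\<integral>x. f x \<partial>M) \<noteq> (\<integral>x. f x \<partial>N)"
    \<comment> \<open>A third of the supposed gap: replacing \<open>f\<close> by a polynomial costs
      at most \<open>d\<close> under each measure, so the gap would be at most \<open>2 * d\<close>,
      although it equals \<open>3 * d\<close>.\<close>
    define d where "d = \<bar>(\<integral>x. f x \<partial>M) - (\<integral>x. f x \<partial>N)\<bar> / 3"
    have "d > 0" using neq by (simp add: d_def)
    then obtain g where g: "real_polynomial_function g"
      "\<And>x. x \<in> {-1..1} \<Longrightarrow> \<bar>f x - g x\<bar> < d"
      using Stone_Weierstrass_real_polynomial_function[of "{-1..1}" f d]
        continuous_on_subset[OF cont, of "{-1..1}"] by auto
    then obtain a n where ga: "g = (\<lambda>x. \<Sum>i\<le>n. a i * x ^ i)"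
      using real_polynomial_function_imp_sum by blast
    have f_meas: "f \<in> borel_measurable borel"
      using cont by (rule borel_measurable_continuous_onI)
    have approx: "\<bar>(\<integral>x. f x \<partial>L) - (\<integral>x. g x \<partial>L)\<bar> \<le> d"
      "(\<integral>x. g x \<partial>L) = (\<Sum>i\<le>n. a i * (\<integral>x. x ^ i \<partial>L))"
      if L: "real_distribution L" "AE x in L. \<bar>x\<bar> \<le> 1" for L :: "real measure"
    proof -
      interpret L: real_distribution L by (rule that(1))
      have [measurable]: "f \<in> borel_measurable L" using f_meas by simp
      have f: "integrable L f"
        using bdd by (intro L.integrable_const_bound[of _ 1]) auto
      show "(\<integral>x. g x \<partial>L) = (\<Sum>i\<le>n. a i * (\<integral>x. x ^ i \<partial>L))"
        unfolding ga using int_pow[OF L] by (subst Bochner_Integration.integral_sum) auto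
      have g': "integrable L g"
        unfolding ga using int_pow[OF L] by auto
      have "\<bar>(\<integral>x. f x \<partial>L) - (\<integral>x. g x \<partial>L)\<bar> = \<bar>\<integral>x. f x - g x \<partial>L\<bar>"
        using f g' by simp
      also have "\<dots> \<le> (\<integral>x. \<bar>f x - g x\<bar> \<partial>L)"
        using integral_norm_bound[of L "\<lambda>x. f x - g x"] by simp
      also have "\<dots> \<le> (\<integral>x. d \<partial>L)"
      proof (rule integral_mono_AE)
        show "AE x in L. \<bar>f x - g x\<bar> \<le> d"
          using that(2) by eventually_elim (use g(2) in \<open>force simp: abs_le_iff intro!: less_imp_le\<close>)
      qed (use f g' in auto)
      also have "\<dots> = d" by (simp add: L.prob_space[unfolded L.space_eq_univ])
      finally show "\<bar>(\<integral>x. f x \<partial>L) - (\<integral>x. g x \<partial>L)\<bar> \<le> d" .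
    qed
    have "(\<integral>x. g x \<partial>M) = (\<integral>x. g x \<partial>N)"
      using approx(2)[OF M] approx(2)[OF N] moments by simp
    then have "\<bar>(\<integral>x. f x \<partial>M) - (\<integral>x. f x \<partial>N)\<bar> \<le> 2 * d"
      using approx(1)[OF M] approx(1)[OF N] by linarith
    then show False using \<open>d > 0\<close> by (simp add: d_def)
  qed
  \<comment> \<open>Splits the characteristic function into real integrals, to which
    \<open>eq_cont\<close> applies.\<close>
  have char_eq: "char L t = Complex (\<integral>x. cos (t * x) \<partial>L) (\<integral>x. sin (t * x) \<partial>L)"
    if "real_distribution L" for L :: "real measure" and t
  proof -
    interpret L: real_distribution L by (rule that)
    have *: "integrable L (\<lambda>x. iexp (t * x))"
      using L.integrable_iexp[of "\<lambda>x. complex_of_real (t * x)"] by simp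
    show ?thesis
      unfolding char_def complex_eq_iff
      using integral_Re[OF *] integral_Im[OF *] by (simp add: Re_exp Im_exp)
  qed
  have "char M t = char N t" for t
    unfolding char_eq[OF M(1)] char_eq[OF N(1)]
    by (intro arg_cong2[where f = Complex] eq_cont continuous_intros) auto
  then show ?thesis
    by (intro Levy_uniqueness M(1) N(1)) auto
qed

text \<open>The index is shifted: \<open>m\<close> belongs to the sphere in dimension \<open>m + 3\<close>.\<close>
definition beta_weight :: "nat \<Rightarrow> real \<Rightarrow> real" where
  "beta_weight m t = sqrt (max 0 (1 - t\<^sup>2)) ^ m"

definition beta_law :: "nat \<Rightarrow> real measure" where
  "beta_law m = density lborel (\<lambda>t. beta_weight m t / (\<integral>t. beta_weight m t \<partial>lborel))"

lemma continuous_beta_weight: "continuous_on A (beta_weight m)"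
  unfolding beta_weight_def by (intro continuous_intros)

lemma measurable_beta_weight [measurable]: "beta_weight m \<in> borel_measurable borel"
  by (intro borel_measurable_continuous_onI continuous_beta_weight)

lemma beta_weight_nonneg [simp]: "0 \<le> beta_weight m t"
  by (simp add: beta_weight_def)

text \<open>Outside the interval the truncation makes the base 0. The exponent must be positive
  because \<open>0 ^ 0 = 1\<close>.\<close>

lemma beta_weight_outside:
  assumes "m > 0" "t \<notin> {-1..1}"
  shows "beta_weight m t = 0"
proof -
  have "\<bar>t\<bar> \<ge> 1" using assms(2) by auto
  then have "1 \<le> t\<^sup>2" by (simp add: abs_le_square_iff[of 1 t, simplified])
  then show ?thesis using assms(1) by (simp add: beta_weight_def)
qed

lemma beta_weight_indicator:
  assumes "m > 0"
  shows "f t * beta_weight m t = indicator {-1..1} t *\<^sub>R (f t * beta_weight m t)"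
  using beta_weight_outside[OF assms, of t] by (auto simp: indicator_def)

lemma integrable_beta_weight:
  assumes "m > 0" "continuous_on UNIV f"
  shows "integrable lborel (\<lambda>t. f t * beta_weight m t)"
proof -
  have "integrable lborel (\<lambda>t. indicator {-1..1} t *\<^sub>R (f t * beta_weight m t))"
    by (rule borel_integrable_compact)
      (auto intro!: continuous_intros continuous_beta_weight continuous_on_subset[OF assms(2)])
  then show ?thesis by (simp only: beta_weight_indicator[OF assms(1), of f, symmetric])
qed

lemma beta_weight_integral_pos:
  assumes "m > 0"
  shows "0 < (\<integral>t. beta_weight m t \<partial>lborel)"
proof -
  have int: "integrable lborel (beta_weight m)"
    using integrable_beta_weight[OF assms, of "\<lambda>_. 1"] by simp
  \<comment> \<open>On this interval of length 1, \<open>1 - t\<^sup>2\<close> is at least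
    \<open>3/4\<close>, which bounds the weight below by a positive constant.\<close>
  have "0 < (\<integral>t. (sqrt 3 / 2) ^ m * indicator {-1/2..1/2::real} t \<partial>lborel)"
    by simp
  also have "\<dots> \<le> (\<integral>t. beta_weight m t \<partial>lborel)"
  proof (rule integral_mono[OF _ int])
    fix t :: real
    show "(sqrt 3 / 2) ^ m * indicator {-1/2..1/2} t \<le> beta_weight m t"
    proof (cases "t \<in> {-1/2..1/2}")
      case True
      then have "\<bar>t\<bar> \<le> 1/2" by auto
      then have "t\<^sup>2 \<le> (1/2)\<^sup>2" by (subst abs_le_square_iff[symmetric]) simp
      then have "3/4 \<le> max 0 (1 - t\<^sup>2)" by (simp add: power2_eq_square)
      then have "sqrt (3/4) \<le> sqrt (max 0 (1 - t\<^sup>2))" by (rule real_sqrt_le_mono)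
      then show ?thesis
        using True by (auto simp: beta_weight_def real_sqrt_divide intro!: power_mono)
    qed simp
  qed simp
  finally show ?thesis .
qed

lemma real_distribution_beta_law:
  assumes "m > 0"
  shows "real_distribution (beta_law m)"
proof -
  have int: "integrable lborel (beta_weight m)"
    using integrable_beta_weight[OF assms, of "\<lambda>_. 1"] by simp
  have "prob_space (beta_law m)"
    unfolding beta_law_def
  proof (rule prob_spaceI)
    have "(\<integral>\<^sup>+t. ennreal (beta_weight m t / (\<integral>t. beta_weight m t \<partial>lborel)) \<partial>lborel) =
      ennreal (\<integral>t. beta_weight m t / (\<integral>t. beta_weight m t \<partial>lborel) \<partial>lborel)"
      using int beta_weight_integral_pos[OF assms] by (intro nn_integral_eq_integral) auto
    then show "emeasure (density lborel (\<lambda>t. beta_weight m t / (\<integral>t. beta_weight m t \<partial>lborel)))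
        (space (density lborel (\<lambda>t. beta_weight m t / (\<integral>t. beta_weight m t \<partial>lborel)))) = 1"
      using beta_weight_integral_pos[OF assms] by (simp add: emeasure_density)
  qed
  then show ?thesis
    by (simp add: real_distribution_def real_distribution_axioms_def beta_law_def)
qed

lemma integral_beta_law:
  assumes "m > 0" and f[measurable]: "f \<in> borel_measurable borel"
  shows "(\<integral>t. f t \<partial>beta_law m) =
    (\<integral>t. f t * beta_weight m t \<partial>lborel) / (\<integral>t. beta_weight m t \<partial>lborel)"
proof -
  have "(\<integral>t. f t \<partial>beta_law m) =
    (\<integral>t. (beta_weight m t / (\<integral>t. beta_weight m t \<partial>lborel)) *\<^sub>R f t \<partial>lborel)"
    using beta_weight_integral_pos[OF assms(1)] unfolding beta_law_def
    by (subst integral_density) auto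
  also have "\<dots> = (\<integral>t. f t * beta_weight m t / (\<integral>t. beta_weight m t \<partial>lborel) \<partial>lborel)"
    by (simp add: mult.commute)
  finally show ?thesis by simp
qed

lemma AE_beta_law:
  assumes "m > 0"
  shows "AE t in beta_law m. \<bar>t\<bar> \<le> 1"
proof -
  have "\<bar>t\<bar> \<le> 1" if "0 < beta_weight m t / (\<integral>t. beta_weight m t \<partial>lborel)" for t
    using that beta_weight_outside[OF assms, of t] by (cases "t \<in> {-1..1}") (auto simp: abs_le_iff)
  then show ?thesis
    unfolding beta_law_def by (subst AE_density) auto
qed

lemma measure_beta_law:
  assumes "m > 0"
  shows "measure (beta_law m) {..t} =
    (\<integral>x. indicator {..t} x * beta_weight m x \<partial>lborel) / (\<integral>t. beta_weight m t \<partial>lborel)"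
proof -
  interpret real_distribution "beta_law m" by (rule real_distribution_beta_law[OF assms])
  have "measure (beta_law m) {..t} = (\<integral>x. indicator {..t} x \<partial>beta_law m)" by simp
  then show ?thesis by (subst integral_beta_law[OF assms, symmetric]) simp_all
qed

text \<open>The weight is even, so the substitution of \<open>- t\<close> for \<open>t\<close>
  changes the sign of the integral.\<close>

lemma beta_moment_odd:
  assumes "odd j"
  shows "(\<integral>t. t ^ j * beta_weight m t \<partial>lborel) = 0"
proof -
  have "(\<integral>t. t ^ j * beta_weight m t \<partial>lborel) = (\<integral>t. (- t) ^ j * beta_weight m (- t) \<partial>lborel)"
    using lborel_integral_real_affine[of "-1" "\<lambda>t. t ^ j * beta_weight m t" 0] by simp
  also have "\<dots> = - (\<integral>t. t ^ j * beta_weight m t \<partial>lborel)"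
    using assms by (simp add: beta_weight_def)
  finally show ?thesis by simp
qed

text \<open>Integrates the derivative of \<open>t\<^sup>j\<^sup>+\<^sup>1 (1 - t\<^sup>2)\<^sup>m\<^sup>/\<^sup>2\<^sup>+\<^sup>1\<close> over \<open>[-1, 1]\<close>.\<close>
lemma beta_moment_rec:
  assumes m: "m > 0"
  shows "(real j + real m + 3) * (\<integral>t. t ^ (j + 2) * beta_weight m t \<partial>lborel) =
    (real j + 1) * (\<integral>t. t ^ j * beta_weight m t \<partial>lborel)"
proof -
  let ?F = "\<lambda>t::real. t ^ (j + 1) * beta_weight (m + 2) t"
  let ?f = "\<lambda>t::real. (real j + 1) * (t ^ j * beta_weight m t) - (real j + real m + 3) * (t ^ (j +
      2) * beta_weight m t)"
  \<comment> \<open>The chain rule goes through \<open>sqrt\<close>, which needs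
    \<open>1 - t\<^sup>2 > 0\<close>. At the endpoints the fundamental theorem used below asks only
    for continuity.\<close>
  have deriv: "(?F has_vector_derivative ?f t) (at t)" if "t \<in> {-1<..<1}" for t
  proof -
    have pos: "0 < 1 - t\<^sup>2" using that by (simp add: abs_square_less_1 abs_less_iff)
    define s where "s = sqrt (1 - t\<^sup>2)"
    have s: "s > 0" "s\<^sup>2 = 1 - t\<^sup>2" using pos by (simp_all add: s_def)
    have "((\<lambda>t. t ^ (j + 1) * sqrt (1 - t\<^sup>2) ^ (m + 2)) has_real_derivative
        real (j + 1) * t ^ j * s ^ (m + 2) +
        t ^ (j + 1) * (real (m + 2) * s ^ (m + 1) * (- (2 * t) * (inverse s / 2)))) (at t)"
    proof -
      have "((\<lambda>t. t ^ (j + 1)) has_real_derivative real (j + 1) * t ^ j) (at t)"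
        using DERIV_pow[of "j + 1" t] by simp
      moreover have "((\<lambda>t. sqrt (1 - t\<^sup>2)) has_real_derivative - (2 * t) * (inverse s / 2)) (at t)"
        using pos unfolding s_def by (auto intro!: derivative_eq_intros simp: field_simps)
      then have "((\<lambda>t. sqrt (1 - t\<^sup>2) ^ (m + 2)) has_real_derivative
          real (m + 2) * s ^ (m + 1) * (- (2 * t) * (inverse s / 2))) (at t)"
        by (rule DERIV_power[THEN DERIV_cong]) (simp add: s_def)
      ultimately show ?thesis
        by (rule DERIV_mult[THEN DERIV_cong]) (simp add: s_def mult_ac)
    qed
    then have "((\<lambda>t. t ^ (j + 1) * sqrt (1 - t\<^sup>2) ^ (m + 2)) has_real_derivative
        (real j + 1) * (t ^ j * s ^ m) - (real j + real m + 3) * (t ^ (j + 2) * s ^ m)) (at t)"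
    proof (rule DERIV_cong)
      have 1: "s ^ (m + 2) = s ^ m * (1 - t\<^sup>2)" by (simp only: power_add s)
      have 2: "real (m + 2) * s ^ (m + 1) * (- (2 * t) * (inverse s / 2)) =
          - real (m + 2) * s ^ m * t"
        using s by (simp add: field_simps)
      show "real (j + 1) * t ^ j * s ^ (m + 2) +
          t ^ (j + 1) * (real (m + 2) * s ^ (m + 1) * (- (2 * t) * (inverse s / 2))) =
          (real j + 1) * (t ^ j * s ^ m) - (real j + real m + 3) * (t ^ (j + 2) * s ^ m)"
        unfolding 1 2 by (simp add: algebra_simps power2_eq_square)
    qed
    moreover have "s ^ m = beta_weight m t"
      using pos by (simp add: s_def beta_weight_def max_def)
    ultimately have "((\<lambda>t. t ^ (j + 1) * sqrt (1 - t\<^sup>2) ^ (m + 2)) has_real_derivative ?f t) (at t)"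
      by simp
    then have "(?F has_real_derivative ?f t) (at t)"
    proof (rule has_field_derivative_transform_within_open)
      show "t \<in> {-1<..<1}" by (rule that)
      fix x :: real assume "x \<in> {-1<..<1}"
      then have "0 < 1 - x\<^sup>2" by (simp add: abs_square_less_1 abs_less_iff)
      then show "x ^ (j + 1) * sqrt (1 - x\<^sup>2) ^ (m + 2) = ?F x"
        by (simp add: beta_weight_def max_def)
    qed simp
    then show ?thesis by (simp add: has_real_derivative_iff_has_vector_derivative)
  qed
  have "(?f has_integral (?F 1 - ?F (-1))) {-1..1}"
    by (rule fundamental_theorem_of_calculus_interior)
      (use deriv in \<open>auto intro!: continuous_intros continuous_beta_weight\<close>)
  \<comment> \<open>Both boundary values vanish because the exponent \<open>m + 2\<close> is
    positive.\<close>
  then have hi: "(?f has_integral 0) {-1..1}" by (simp add: beta_weight_def)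
  have i1: "integrable lborel (\<lambda>t. t ^ i * beta_weight m t)" for i
    by (intro integrable_beta_weight m continuous_intros)
  \<comment> \<open>As \<open>?f\<close> is zero outside \<open>[-1, 1]\<close>, its integral over
    the interval is its integral over the line.\<close>
  have f_ind: "?f t = indicator {-1..1} t *\<^sub>R ?f t" for t
    using beta_weight_outside[OF m, of t] by (auto simp: indicator_def)
  have "integrable lborel (\<lambda>t. indicator {-1..1} t *\<^sub>R ?f t)"
    unfolding f_ind[symmetric] using i1 by (intro Bochner_Integration.integrable_diff
        integrable_mult_right)
  then have "set_integrable lborel {-1..1} ?f" by (simp add: set_integrable_def)
  then have "(LINT t:{-1..1}|lborel. ?f t) = integral {-1..1} ?f"
    by (rule set_borel_integral_eq_integral(2))
  also have "\<dots> = 0"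
    using hi by (rule integral_unique)
  finally have "(LINT t:{-1..1}|lborel. ?f t) = 0" .
  then have "(\<integral>t. ?f t \<partial>lborel) = 0"
    unfolding set_lebesgue_integral_def f_ind[symmetric] .
  moreover have "(\<integral>t. ?f t \<partial>lborel) = (real j + 1) * (\<integral>t. t ^ j * beta_weight m t \<partial>lborel)
      - (real j + real m + 3) * (\<integral>t. t ^ (j + 2) * beta_weight m t \<partial>lborel)"
    by (subst Bochner_Integration.integral_diff)
      (simp_all only: integral_mult_right_zero integrable_mult_right[OF i1])
  ultimately show ?thesis by linarith
qed

context uniform_sphere_basis
begin

text \<open>Both laws live on \<open>[-1, 1]\<close> and have vanishing odd moments. Their even
  moments start at 1 and obey the same recursion, since
  \<open>2 * i + card B = 2 * i + m + 3\<close>; hence all moments agree.\<close>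

lemma distr_dot_eq_beta_law:
  assumes e: "e \<in> B" and k: "card B = m + 3" "m > 0"
  shows "distr \<mu> borel (\<lambda>x. dot p x e) = beta_law m"
proof (rule real_distribution_eqI_moments)
  interpret L: real_distribution "beta_law m" by (rule real_distribution_beta_law[OF k(2)])
  show "real_distribution (distr \<mu> borel (\<lambda>x. dot p x e))"
    by (rule real_distribution_distr) measurable
  show "AE x in distr \<mu> borel (\<lambda>x. dot p x e). \<bar>x\<bar> \<le> 1"
    using AE_abs_dot_le_1[OF e] by (subst AE_distr_iff) auto
  show "real_distribution (beta_law m)" by unfold_locales
  show "AE x in beta_law m. \<bar>x\<bar> \<le> 1" by (rule AE_beta_law[OF k(2)])
  fix j
  let ?S = "\<integral>t. beta_weight m t \<partial>lborel"
  have even_case: "(\<integral>x. dot p x e ^ (2 * i) \<partial>\<mu>) = (\<integral>t. t ^ (2 * i) * beta_weight m t \<partial>lborel) / ?S"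
      for i
  proof (induction i)
    case 0
    then show ?case using beta_weight_integral_pos[OF k(2)] prob_space by simp
  next
    case (Suc i)
    have "(2 * real i + real m + 3) * (\<integral>x. dot p x e ^ (2 * Suc i) \<partial>\<mu>) =
      (2 * real i + 1) * (\<integral>x. dot p x e ^ (2 * i) \<partial>\<mu>)"
      using even_moment_rec[OF e, of i] k(1) by (simp add: add.assoc)
    also have "\<dots> = (2 * real i + 1) * (\<integral>t. t ^ (2 * i) * beta_weight m t \<partial>lborel) / ?S"
      by (simp add: Suc)
    also have "(2 * real i + 1) * (\<integral>t. t ^ (2 * i) * beta_weight m t \<partial>lborel) =
        (2 * real i + real m + 3) * (\<integral>t. t ^ (2 * Suc i) * beta_weight m t \<partial>lborel)"
      using beta_moment_rec[OF k(2), of "2 * i"] by simp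
    finally have "(2 * real i + real m + 3) * (\<integral>x. dot p x e ^ (2 * Suc i) \<partial>\<mu>) =
      (2 * real i + real m + 3) * ((\<integral>t. t ^ (2 * Suc i) * beta_weight m t \<partial>lborel) / ?S)" by simp
    then show ?case
      by (subst (asm) mult_cancel_left) linarith
  qed
  have "(\<integral>x. x ^ j \<partial>distr \<mu> borel (\<lambda>x. dot p x e)) = (\<integral>x. dot p x e ^ j \<partial>\<mu>)"
    by (subst integral_distr) auto
  also have "\<dots> = (\<integral>t. t ^ j * beta_weight m t \<partial>lborel) / ?S"
  proof (cases "even j")
    case True
    then show ?thesis using even_case[of "j div 2"] by simp
  next
    case False
    then show ?thesis
      using odd_moment_zero[of e j] basis_facts[OF e] beta_moment_odd[of j m] by simp
  qed
  also have "\<dots> = (\<integral>x. x ^ j \<partial>beta_law m)"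
    by (subst integral_beta_law[OF k(2)]) auto
  finally show "(\<integral>x. x ^ j \<partial>distr \<mu> borel (\<lambda>x. dot p x e)) = (\<integral>x. x ^ j \<partial>beta_law m)" .
qed

end

context uniform_sphere
begin

text \<open>By Fubini, fix the second point \<open>y\<close> first. Almost every \<open>y\<close> is
  a unit vector of \<open>H\<close>, and for such \<open>y\<close> the probability is that for a
  basis vector \<open>e\<close>, so the outer integrand is constant.\<close>

lemma prob_dot_le:
  assumes k: "dim H = m + 3" "m > 0"
  shows "\<P>(z in \<mu> \<Otimes>\<^sub>M \<mu>. dot p (fst z) (snd z) \<le> t) = measure (beta_law m) {..t}"
proof -
  interpret P: pair_prob_space \<mu> \<mu> by unfold_locales
  obtain B where basis': "orthonormal p B" "span B = H" "card B = dim H"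
    using orthonormal_basis_exists[OF subspace_H H_subset] k(1) by auto
  interpret uniform_sphere_basis p H \<mu> B
    by unfold_locales (use basis' in auto)
  obtain e where e: "e \<in> B" using basis'(3) k(1) by (metis card.empty ex_in_conv add_is_0
      zero_neq_numeral)
  interpret L: real_distribution "beta_law m" by (rule real_distribution_beta_law[OF k(2)])
  let ?A = "{z \<in> space (\<mu> \<Otimes>\<^sub>M \<mu>). dot p (fst z) (snd z) \<le> t}"
  have law: "emeasure \<mu> {x \<in> space \<mu>. dot p x y \<le> t} = measure (beta_law m) {..t}"
    if y: "y \<in> H" "y \<in> space \<mu>" for y
  proof -
    have "dot p y y = dot p e e"
      using y(2) basis_facts[OF e] by (simp add: space_eq unit_sphere_eq)
    then have "(\<integral>x. indicat_real {..t} (dot p x y) \<partial>\<mu>) = (\<integral>x. indicat_real {..t} (dot p x e) \<partial>\<mu>)"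
      using y(1) basis_facts[OF e]
      by (intro integral_dot_cong[where f = "indicat_real {..t}"]) auto
    moreover have "(\<integral>x. indicat_real {..t} (dot p x v) \<partial>\<mu>) = measure \<mu> {x \<in> space \<mu>. dot p x v \<le> t}"
        for v
    proof -
      have "(\<integral>x. indicat_real {..t} (dot p x v) \<partial>\<mu>) = (\<integral>x. indicat_real {x \<in> space \<mu>. dot p x v \<le>
          t} x \<partial>\<mu>)"
        by (intro Bochner_Integration.integral_cong) (auto simp: indicator_def)
      then show ?thesis by simp
    qed
    ultimately have "measure \<mu> {x \<in> space \<mu>. dot p x y \<le> t} = measure \<mu> {x \<in> space \<mu>. dot p x e \<le> t}"
      by simp
    also have "\<dots> = measure (distr \<mu> borel (\<lambda>x. dot p x e)) {..t}"
      by (subst measure_distr) (auto intro!: arg_cong[where f = "measure \<mu>"])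
    also have "\<dots> = measure (beta_law m) {..t}"
      using distr_dot_eq_beta_law[OF e _ k(2)] basis'(3) k(1) by simp
    finally show ?thesis by (simp add: emeasure_eq_measure)
  qed
  have meas: "?A \<in> sets (\<mu> \<Otimes>\<^sub>M \<mu>)" by measurable
  have "emeasure (\<mu> \<Otimes>\<^sub>M \<mu>) ?A = (\<integral>\<^sup>+y. emeasure \<mu> ((\<lambda>x. (x, y)) -` ?A) \<partial>\<mu>)"
    by (rule P.emeasure_pair_measure_alt2[OF meas])
  also have "\<dots> = (\<integral>\<^sup>+y. measure (beta_law m) {..t} \<partial>\<mu>)"
  proof (rule nn_integral_cong_AE)
    show "AE y in \<mu>. emeasure \<mu> ((\<lambda>x. (x, y)) -` ?A) = ennreal (measure (beta_law m) {..t})"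
      using AE_in_H AE_space
    proof eventually_elim
      case (elim y)
      have "(\<lambda>x. (x, y)) -` ?A = {x \<in> space \<mu>. dot p x y \<le> t}"
        using elim by (auto simp: space_pair_measure)
      then show ?case using law[of y] elim by simp
    qed
  qed
  also have "\<dots> = ennreal (measure (beta_law m) {..t})"
    by (simp add: emeasure_space_1)
  finally show ?thesis
    by (simp add: measure_def)
qed

end

section \<open>The Gaussian limit\<close>

text \<open>The bound holds only from some \<open>N\<close> on, so dominated convergence is applied
  to the sequence shifted by \<open>N\<close>.\<close>

lemma eventually_dominated_convergence:
  fixes f :: "nat \<Rightarrow> real \<Rightarrow> real"
  assumes meas: "\<And>n. f n \<in> borel_measurable lborel" "g \<in> borel_measurable lborel"
    and w: "integrable lborel w"
    and lim: "\<And>x. (\<lambda>n. f n x) \<longlonglongrightarrow> g x"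
    and bound: "eventually (\<lambda>n. \<forall>x. \<bar>f n x\<bar> \<le> w x) sequentially"
  shows "(\<lambda>n. \<integral>x. f n x \<partial>lborel) \<longlonglongrightarrow> (\<integral>x. g x \<partial>lborel)"
    and "integrable lborel g"
    and "eventually (\<lambda>n. integrable lborel (f n)) sequentially"
proof -
  obtain N where N: "\<And>n x. n \<ge> N \<Longrightarrow> \<bar>f n x\<bar> \<le> w x"
    using bound unfolding eventually_sequentially by blast
  have lim': "AE x in lborel. (\<lambda>n. f (n + N) x) \<longlonglongrightarrow> g x"
    by (intro AE_I2 LIMSEQ_ignore_initial_segment lim)
  have bound': "AE x in lborel. norm (f (n + N) x) \<le> w x" for n
    using N by (intro AE_I2) simp
  have "(\<lambda>n. \<integral>x. f (n + N) x \<partial>lborel) \<longlonglongrightarrow> (\<integral>x. g x \<partial>lborel)"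
    by (rule integral_dominated_convergence[OF meas(2) meas(1) w lim' bound'])
  then show "(\<lambda>n. \<integral>x. f n x \<partial>lborel) \<longlonglongrightarrow> (\<integral>x. g x \<partial>lborel)"
    by (rule LIMSEQ_offset)
  show "integrable lborel g"
    by (rule integrable_dominated_convergence[OF meas(2) meas(1) w lim' bound'])
  have "integrable lborel (f n)" if "n \<ge> N" for n
    using w meas(1)
  proof (rule Bochner_Integration.integrable_bound)
    show "AE x in lborel. norm (f n x) \<le> norm (w x)"
      using order_trans[OF N[OF that] abs_ge_self] by (intro AE_I2) simp
  qed
  then show "eventually (\<lambda>n. integrable lborel (f n)) sequentially"
    unfolding eventually_sequentially by blast
qed

lemma mult_ln_one_minus_limit:
  fixes x :: real
  shows "((\<lambda>y. y * ln (1 - x / y)) \<longlongrightarrow> - x) at_top"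
  by real_asymp

text \<open>Squeezes by \<open>d / (1 + d) \<le> 1 - exp (- d) \<le> d\<close> for nonnegative
  \<open>d\<close>. Convergence of \<open>n * d n\<close> forces \<open>d n\<close> to tend to 0, so
  both bounds have the same limit after multiplication by \<open>n\<close>.\<close>

lemma sequence_one_minus_exp_limit:
  fixes d :: "nat \<Rightarrow> real"
  assumes "(\<lambda>n. real n * d n) \<longlonglongrightarrow> z" and nonneg: "eventually (\<lambda>n. 0 \<le> d n) sequentially"
  shows "(\<lambda>n. real n * (1 - exp (- d n))) \<longlonglongrightarrow> z"
proof (rule tendsto_sandwich)
  have "(\<lambda>n. real n * d n * (1 / real n)) \<longlonglongrightarrow> z * 0"
    by (intro tendsto_mult assms(1) lim_1_over_n)
  moreover have "eventually (\<lambda>n. real n * d n * (1 / real n) = d n) sequentially"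
    using eventually_gt_at_top[of 0] by eventually_elim simp
  ultimately have "d \<longlonglongrightarrow> 0" by (simp add: filterlim_cong)
  then have "(\<lambda>n. real n * d n / (1 + d n)) \<longlonglongrightarrow> z / (1 + 0)"
    by (intro tendsto_divide tendsto_add tendsto_const assms(1)) auto
  then show "(\<lambda>n. real n * d n / (1 + d n)) \<longlonglongrightarrow> z" by simp
  show "eventually (\<lambda>n. real n * d n / (1 + d n) \<le> real n * (1 - exp (- d n))) sequentially"
    using nonneg
  proof eventually_elim
    case (elim n)
    have "exp (- d n) \<le> 1 / (1 + d n)"
      using elim exp_ge_add_one_self[of "d n"] by (simp add: exp_minus field_simps)
    then have "d n / (1 + d n) \<le> 1 - exp (- d n)"
      using elim by (simp add: field_simps)
    then have "real n * (d n / (1 + d n)) \<le> real n * (1 - exp (- d n))"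
      by (rule mult_left_mono) simp
    then show ?case by simp
  qed
  have "real n * (1 - exp (- d n)) \<le> real n * d n" for n
    using exp_ge_add_one_self[of "- d n"] by (intro mult_left_mono) auto
  then show "eventually (\<lambda>n. real n * (1 - exp (- d n)) \<le> real n * d n) sequentially" by simp
qed (rule assms(1))

section \<open>Gaussian integrals\<close>

lemma integrable_power_gauss: "integrable lborel (\<lambda>v::real. v ^ k * exp (- v\<^sup>2 / 4))"
proof -
  \<comment> \<open>Standard deviation \<open>sqrt 2\<close> is the choice that gives the exponent
    \<open>- x\<^sup>2 / 4\<close>.\<close>
  have "integrable lborel (\<lambda>x. normal_density 0 (sqrt 2) x * (x - 0) ^ k)"
    by (rule integrable_normal_moment) simp
  then have "integrable lborel (\<lambda>x. sqrt (4 * pi) * (normal_density 0 (sqrt 2) x * x ^ k))"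
    by (intro integrable_mult_right) simp
  moreover have "sqrt (4 * pi) * (normal_density 0 (sqrt 2) x * x ^ k) = x ^ k * exp (- x\<^sup>2 / 4)"
      for x
    by (simp add: normal_density_def)
  ultimately show ?thesis by simp
qed

lemma std_normal_density_eq: "std_normal_density v = exp (- v\<^sup>2 / 2) / sqrt (2 * pi)"
  by (simp add: std_normal_density_def)

lemma integral_gauss: "(\<integral>v. exp (- (v::real)\<^sup>2 / 2) \<partial>lborel) = sqrt (2 * pi)"
  using integral_std_normal_moment_even[of 0] by (simp add: std_normal_density_eq field_simps)

lemma integral_square_gauss: "(\<integral>v. (v::real)\<^sup>2 * exp (- v\<^sup>2 / 2) \<partial>lborel) = sqrt (2 * pi)"
  using integral_std_normal_moment_even[of 1]
  by (simp add: std_normal_density_eq field_simps power2_eq_square)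

lemma integrable_hermite_gauss: "integrable lborel (\<lambda>v. (v\<^sup>2 - 1) * std_normal_density v)"
proof -
  have "integrable lborel (\<lambda>v. std_normal_density v * v ^ 2 - std_normal_density v * v ^ 0)"
    by (intro Bochner_Integration.integrable_diff integrable_std_normal_moment)
  then show ?thesis by (simp add: algebra_simps)
qed

text \<open>The antiderivative \<open>- v * std_normal_density v\<close> tends to 0 at minus
  infinity, so only its value at \<open>u\<close> remains.\<close>

lemma integral_hermite_gauss:
  "(\<integral>v. indicator {..u} v * ((v\<^sup>2 - 1) * std_normal_density v) \<partial>lborel) = - u * std_normal_density u"
proof -
  let ?f = "\<lambda>v. (v\<^sup>2 - 1) * std_normal_density v"
  let ?F = "\<lambda>v::real. - v * std_normal_density v"
  have ei: "einterval (-\<infinity>) (ereal u) = {..<u}" by (auto simp: einterval_def)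
  have "(LBINT v=-\<infinity>..ereal u. ?f v) = ?F u - 0"
  proof (rule interval_integral_FTC_integrable)
    show "(?F has_vector_derivative ?f v) (at v)" for v
    proof -
      have "((\<lambda>v. - v * exp (- v\<^sup>2 / 2)) has_real_derivative (v\<^sup>2 - 1) * exp (- v\<^sup>2 / 2)) (at v)"
        by (auto intro!: derivative_eq_intros simp: field_simps power2_eq_square)
      then show ?thesis
        using DERIV_cdivide[of "\<lambda>v. - v * exp (- v\<^sup>2 / 2)" _ v UNIV "sqrt (2 * pi)"]
        by (simp add: has_real_derivative_iff_has_vector_derivative[symmetric] std_normal_density_eq)
    qed
    show "isCont ?f v" for v
      unfolding std_normal_density_eq by (intro continuous_intros) auto
    have "integrable lborel (\<lambda>v. indicator {..<u} v *\<^sub>R ?f v)"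
      by (intro integrable_mult_indicator integrable_hermite_gauss) auto
    then show "set_integrable lborel (einterval (-\<infinity>) (ereal u)) ?f"
      unfolding set_integrable_def ei .
    have "(?F \<longlongrightarrow> 0) at_bot"
      unfolding std_normal_density_eq by real_asymp
    then show "((?F \<circ> real_of_ereal) \<longlongrightarrow> 0) (at_right (-\<infinity>))"
      by (simp add: ereal_tendsto_simps)
    have "isCont ?F u"
      unfolding std_normal_density_eq by (intro continuous_intros) auto
    then have "(?F \<longlongrightarrow> ?F u) (at_left u)"
      by (simp add: isCont_def filterlim_at_split)
    then show "((?F \<circ> real_of_ereal) \<longlongrightarrow> ?F u) (at_left (ereal u))"
      by (simp add: ereal_tendsto_simps)
  qed simp
  then have "(\<integral>v. indicator {..<u} v *\<^sub>R ?f v \<partial>lborel) = ?F u"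
    by (simp add: interval_lebesgue_integral_def set_lebesgue_integral_def ei)
  \<comment> \<open>The interval integral is taken over the open half-line; adding the endpoint
    changes only a null set.\<close>
  moreover have "(\<integral>v. indicator {..<u} v *\<^sub>R ?f v \<partial>lborel) = (\<integral>v. indicator {..u} v * ?f v \<partial>lborel)"
  proof (rule integral_cong_AE)
    show "AE v in lborel. indicator {..<u} v *\<^sub>R ?f v = indicator {..u} v * ?f v"
      using AE_lborel_singleton[of u] by eventually_elim (auto simp: indicator_def)
  qed auto
  ultimately show ?thesis by simp
qed

section \<open>Rescaled weights and their Gaussian bounds\<close>

definition scaled_weight :: "real \<Rightarrow> nat \<Rightarrow> real \<Rightarrow> real" where
  "scaled_weight y m v = beta_weight m (v / sqrt y)"

lemma measurable_scaled_weight [measurable]: "scaled_weight y m \<in> borel_measurable borel"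
  unfolding scaled_weight_def by measurable

lemma scaled_weight_nonneg: "0 \<le> scaled_weight y m v"
  by (simp add: scaled_weight_def)

lemma scaled_weight_eq:
  assumes "y > 0"
  shows "scaled_weight y m v = sqrt (max 0 (1 - v\<^sup>2 / y)) ^ m"
  using assms by (simp add: scaled_weight_def beta_weight_def power_divide)

text \<open>Separates the two limits needed later: the ratio \<open>m / y\<close> tends to 1, and
  \<open>y * ln (1 - v\<^sup>2 / y)\<close> tends to \<open>- v\<^sup>2\<close>.\<close>

lemma scaled_weight_exp:
  assumes "y > v\<^sup>2"
  shows "scaled_weight y m v = exp (real m / y / 2 * (y * ln (1 - v\<^sup>2 / y)))"
proof -
  have y: "y > 0" using assms zero_le_power2[of v] by linarith
  then have pos: "0 < 1 - v\<^sup>2 / y" using assms by simp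
  have "sqrt (1 - v\<^sup>2 / y) = exp (ln (1 - v\<^sup>2 / y) / 2)"
    using pos by (intro real_sqrt_unique) (simp_all add: power2_eq_square flip: exp_add)
  then have "sqrt (1 - v\<^sup>2 / y) ^ m = exp (real m * (ln (1 - v\<^sup>2 / y) / 2))"
    by (simp only: exp_of_nat_mult)
  then show ?thesis using y pos by (simp add: scaled_weight_eq max_def)
qed

text \<open>From \<open>1 - x \<le> exp (- x)\<close> the weight is at most
  \<open>exp (- v\<^sup>2 * (m / y) / 2)\<close>, and the ratio \<open>m / y\<close> is at least one
  half. The resulting bound depends on neither \<open>m\<close> nor \<open>y\<close>, as domination
  requires.\<close>

lemma scaled_weight_le_gauss:
  assumes "y > 0" "y \<le> 2 * real m"
  shows "scaled_weight y m v \<le> exp (- v\<^sup>2 / 4)"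
proof -
  have "max 0 (1 - v\<^sup>2 / y) \<le> exp (- (v\<^sup>2 / y))"
    using exp_ge_add_one_self[of "- (v\<^sup>2 / y)"] by simp
  then have "sqrt (max 0 (1 - v\<^sup>2 / y)) \<le> sqrt (exp (- (v\<^sup>2 / y)))"
    by (rule real_sqrt_le_mono)
  also have "\<dots> = exp (- (v\<^sup>2 / y) / 2)"
    by (intro real_sqrt_unique) (simp_all add: power2_eq_square flip: exp_add)
  finally have "sqrt (max 0 (1 - v\<^sup>2 / y)) ^ m \<le> exp (- (v\<^sup>2 / y) / 2) ^ m"
    by (rule power_mono) simp
  also have "\<dots> = exp (- (v\<^sup>2 * (real m / y) / 2))"
    by (simp flip: exp_of_nat_mult)
  also have "\<dots> \<le> exp (- v\<^sup>2 / 4)"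
  proof -
    have "1 / 2 \<le> real m / y" using assms by (simp add: field_simps)
    then have "v\<^sup>2 * (1 / 2) \<le> v\<^sup>2 * (real m / y)" by (rule mult_left_mono) simp
    then show ?thesis by (simp add: mult_ac)
  qed
  finally show ?thesis using assms(1) by (simp add: scaled_weight_eq)
qed

lemma scaled_weight_add: "scaled_weight y (m + d) v = scaled_weight y m v * scaled_weight y d v"
  by (simp add: scaled_weight_def beta_weight_def power_add)

text \<open>With \<open>s\<close> the base of the power, Bernoulli's inequality gives
  \<open>1 - s ^ d \<le> d * (1 - s)\<close>, and \<open>0 \<le> s \<le> 1\<close> gives
  \<open>1 - s \<le> 1 - s\<^sup>2 \<le> v\<^sup>2 / y\<close>.\<close>

lemma one_minus_scaled_weight:
  assumes "y > 0"
  shows "0 \<le> 1 - scaled_weight y d v" "1 - scaled_weight y d v \<le> real d * v\<^sup>2 / y"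
proof -
  define s where "s = sqrt (max 0 (1 - v\<^sup>2 / y))"
  have s: "0 \<le> s" "s \<le> 1" "s\<^sup>2 = max 0 (1 - v\<^sup>2 / y)"
    using assms by (simp_all add: s_def)
  have w: "scaled_weight y d v = s ^ d" using assms by (simp add: scaled_weight_eq s_def)
  show "0 \<le> 1 - scaled_weight y d v"
    using s by (simp add: w power_le_one)
  have "1 + real d * (s - 1) \<le> (1 + (s - 1)) ^ d"
    using s by (intro Bernoulli_inequality) simp
  then have "1 - s ^ d \<le> real d * (1 - s)" by (simp add: algebra_simps)
  also have "1 - s \<le> v\<^sup>2 / y"
  proof -
    have "s\<^sup>2 \<le> s" using s(1,2) by (simp add: power2_eq_square mult_left_le)
    moreover have "1 - v\<^sup>2 / y \<le> s\<^sup>2" using s(3) by simp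
    ultimately show ?thesis by linarith
  qed
  then have "real d * (1 - s) \<le> real d * (v\<^sup>2 / y)" by (rule mult_left_mono) simp
  finally show "1 - scaled_weight y d v \<le> real d * v\<^sup>2 / y" by (simp add: w)
qed

text \<open>The substitution \<open>x = v / sqrt y\<close> puts the same factor in numerator and
  denominator. The scale \<open>y\<close> is independent of \<open>m\<close>, so the law in
  dimension \<open>k\<close> can be viewed at the scale of dimension \<open>p\<close>.\<close>

lemma measure_beta_law_scaled:
  assumes "m > 0" "y > 0"
  shows "measure (beta_law m) {..u / sqrt y} =
    (\<integral>v. indicator {..u} v * scaled_weight y m v \<partial>lborel) / (\<integral>v. scaled_weight y m v \<partial>lborel)"
proof -
  have sc: "(\<integral>x. f x \<partial>lborel) = (1 / sqrt y) * (\<integral>v. f (v / sqrt y) \<partial>lborel)" 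
    for f :: "real \<Rightarrow> real"
    using lborel_integral_real_affine[of "1 / sqrt y" f 0] assms(2) by simp
  have "(\<integral>x. indicator {..u / sqrt y} x * beta_weight m x \<partial>lborel) =
    (1 / sqrt y) * (\<integral>v. indicator {..u} v * scaled_weight y m v \<partial>lborel)"
    using assms(2)
    by (subst sc) (auto simp: scaled_weight_def indicator_def divide_le_cancel intro!:
        Bochner_Integration.integral_cong)
  moreover have "(\<integral>x. beta_weight m x \<partial>lborel) = (1 / sqrt y) * (\<integral>v. scaled_weight y m v \<partial>lborel)"
    by (subst sc) (simp add: scaled_weight_def[abs_def])
  ultimately show ?thesis
    using assms(2) by (simp add: measure_beta_law[OF assms(1)])
qed

section \<open>The asymptotic regime and the limits of the weights\<close>

locale dimension_limit =
  fixes P K :: "nat \<Rightarrow> nat" and \<tau> :: real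
  assumes K_le_P: "\<And>n. n \<ge> 1 \<Longrightarrow> 1 \<le> K n \<and> K n \<le> P n"
    and P_over_n: "filterlim (\<lambda>n. real (P n) / real n) at_top sequentially"
    and codim: "(\<lambda>n. (1 - real (K n) / real (P n)) * real n) \<longlonglongrightarrow> \<tau>"
    and tau_pos: "\<tau> > 0"
begin

lemma P_pos: "n \<ge> 1 \<Longrightarrow> 0 < real (P n)"
  using K_le_P[of n] by simp

lemma P_at_top: "filterlim (\<lambda>n. real (P n)) at_top sequentially"
proof (rule filterlim_at_top_mono[OF P_over_n])
  show "eventually (\<lambda>n. real (P n) / real n \<le> real (P n)) sequentially"
    using eventually_ge_at_top[of 1]
    by eventually_elim (simp add: divide_le_eq mult_le_cancel_left1)
qed

text \<open>The deficit \<open>1 - K n / P n\<close> is a convergent sequence times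
  \<open>1 / n\<close>.\<close>

lemma K_over_P: "(\<lambda>n. real (K n) / real (P n)) \<longlonglongrightarrow> 1"
proof -
  have "(\<lambda>n. 1 - (1 - real (K n) / real (P n)) * real n * (1 / real n)) \<longlonglongrightarrow> 1 - \<tau> * 0"
    by (intro tendsto_diff tendsto_mult tendsto_const codim lim_1_over_n)
  moreover have "eventually (\<lambda>n. 1 - (1 - real (K n) / real (P n)) * real n * (1 / real n) =
      real (K n) / real (P n)) sequentially"
    using eventually_ge_at_top[of 1] by eventually_elim simp
  ultimately show ?thesis by (simp add: filterlim_cong)
qed

lemma const_over_P: "(\<lambda>n. c / real (P n)) \<longlonglongrightarrow> 0"
  by (rule tendsto_divide_0[OF tendsto_const filterlim_at_top_imp_at_infinity[OF P_at_top]])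

lemma K_minus_3_over_P: "(\<lambda>n. (real (K n) - 3) / real (P n)) \<longlonglongrightarrow> 1"
  using tendsto_diff[OF K_over_P const_over_P[of 3]] by (simp add: diff_divide_distrib)

text \<open>Makes the index \<open>K n - 3\<close> of the beta law positive, and supplies the
  hypothesis \<open>y \<le> 2 * m\<close> of the Gaussian bound.\<close>

lemma eventually_K_large: "eventually (\<lambda>n. n \<ge> 1 \<and> K n > 3 \<and> real (P n) \<le> 2 * real (K n - 3))
    sequentially"
proof -
  have "eventually (\<lambda>n. 1 / 2 < (real (K n) - 3) / real (P n)) sequentially"
    by (rule order_tendstoD(1)[OF K_minus_3_over_P]) simp
  then show ?thesis
    using eventually_ge_at_top[of 1]
  proof eventually_elim
    case (elim n)
    then have *: "real (P n) / 2 < real (K n) - 3"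
      using P_pos[of n] by (simp add: field_simps)
    then have "K n > 3" using P_pos[of n] elim by linarith
    then show ?case using * elim by (simp add: of_nat_diff)
  qed
qed

text \<open>Expresses the codimension as the natural number \<open>P n - K n\<close>, the exponent
  by which the two weights differ.\<close>

lemma codim_alt: "(\<lambda>n. real n * (real (P n - K n) / real (P n))) \<longlonglongrightarrow> \<tau>"
proof -
  have "eventually (\<lambda>n. (1 - real (K n) / real (P n)) * real n =
      real n * (real (P n - K n) / real (P n))) sequentially"
    using eventually_ge_at_top[of 1]
  proof eventually_elim
    case (elim n)
    then show ?case using K_le_P[of n] by (simp add: of_nat_diff diff_divide_distrib mult.commute)
  qed
  then show ?thesis using codim by (simp add: filterlim_cong)
qed

text \<open>Both weights are taken at the scale \<open>P n\<close>, also the one for dimension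
  \<open>K n\<close>; only then does one divide the other.\<close>

definition weight_K :: "nat \<Rightarrow> real \<Rightarrow> real" where
  "weight_K n v = scaled_weight (real (P n)) (K n - 3) v"

definition weight_P :: "nat \<Rightarrow> real \<Rightarrow> real" where
  "weight_P n v = scaled_weight (real (P n)) (P n - 3) v"

lemma measurable_weights [measurable]: "weight_K n \<in> borel_measurable borel"
    "weight_P n \<in> borel_measurable borel"
  unfolding weight_K_def weight_P_def by measurable

lemma eventually_P_gt: "eventually (\<lambda>n. c < real (P n)) sequentially"
  using P_at_top by (simp add: filterlim_at_top_dense)

lemma P_ln_limit: "(\<lambda>n. real (P n) * ln (1 - v\<^sup>2 / real (P n))) \<longlonglongrightarrow> - v\<^sup>2"
  using filterlim_compose[OF mult_ln_one_minus_limit P_at_top] .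

text \<open>For fixed \<open>v\<close>, eventually \<open>P n > v\<^sup>2\<close>, and the
  exponential form of the weight applies.\<close>

lemma scaled_weight_limit:
  assumes "(\<lambda>n. real (m n) / real (P n)) \<longlonglongrightarrow> 1"
  shows "(\<lambda>n. scaled_weight (real (P n)) (m n) v) \<longlonglongrightarrow> exp (- v\<^sup>2 / 2)"
proof -
  have "(\<lambda>n. exp (real (m n) / real (P n) / 2 * (real (P n) * ln (1 - v\<^sup>2 / real (P n)))))
      \<longlonglongrightarrow> exp (1 / 2 * (- v\<^sup>2))"
    by (intro tendsto_exp tendsto_mult tendsto_divide tendsto_const assms P_ln_limit) simp
  moreover have "eventually (\<lambda>n. exp (real (m n) / real (P n) / 2 * (real (P n) * ln (1 - v\<^sup>2 / real (P n)))) =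
      scaled_weight (real (P n)) (m n) v) sequentially"
    using eventually_P_gt[of "v\<^sup>2"] by eventually_elim (simp only: scaled_weight_exp)
  ultimately show ?thesis by (simp add: filterlim_cong)
qed

lemma weight_K_limit: "(\<lambda>n. weight_K n v) \<longlonglongrightarrow> exp (- v\<^sup>2 / 2)"
  unfolding weight_K_def
proof (rule scaled_weight_limit)
  have "eventually (\<lambda>n. (real (K n) - 3) / real (P n) = real (K n - 3) / real (P n)) sequentially"
    using eventually_K_large by eventually_elim (simp add: of_nat_diff)
  with K_minus_3_over_P show "(\<lambda>n. real (K n - 3) / real (P n)) \<longlonglongrightarrow> 1"
    by (rule Lim_transform_eventually)
qed

lemma weight_P_limit: "(\<lambda>n. weight_P n v) \<longlonglongrightarrow> exp (- v\<^sup>2 / 2)"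
  unfolding weight_P_def
proof (rule scaled_weight_limit)
  have "eventually (\<lambda>n. 1 - 3 / real (P n) = real (P n - 3) / real (P n)) sequentially"
    using eventually_K_large eventually_P_gt[of 3]
    by eventually_elim (simp add: of_nat_diff diff_divide_distrib)
  moreover have "(\<lambda>n. 1 - 3 / real (P n)) \<longlonglongrightarrow> 1 - 0"
    by (intro tendsto_diff tendsto_const const_over_P)
  ultimately show "(\<lambda>n. real (P n - 3) / real (P n)) \<longlonglongrightarrow> 1"
    by (simp add: filterlim_cong)
qed

text \<open>Since \<open>K n \<le> P n\<close>, the weight for \<open>P n\<close> is that for
  \<open>K n\<close> times a factor with exponent \<open>P n - K n\<close>. The difference thus
  reduces to one minus that factor, which is of order \<open>1 / n\<close>.\<close>

lemma eventually_diff_eq: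
  "eventually (\<lambda>n. \<forall>v. weight_K n v - weight_P n v = weight_K n v * (1 - scaled_weight (real (P n))
      (P n - K n) v)) sequentially"
  using eventually_K_large
proof eventually_elim
  case (elim n)
  then have "P n - 3 = (K n - 3) + (P n - K n)" using K_le_P[of n] by simp
  then have "weight_P n v = weight_K n v * scaled_weight (real (P n)) (P n - K n) v" for v
    unfolding weight_P_def weight_K_def by (simp only: scaled_weight_add)
  then show ?case by (simp add: algebra_simps)
qed

lemma weight_bounds:
  "eventually (\<lambda>n. \<forall>v. \<bar>weight_K n v\<bar> \<le> exp (- v\<^sup>2 / 4)) sequentially"
  "eventually (\<lambda>n. \<forall>v. \<bar>weight_P n v\<bar> \<le> exp (- v\<^sup>2 / 4)) sequentially"
  "eventually (\<lambda>n. \<forall>v. \<bar>real n * (weight_K n v - weight_P n v)\<bar> \<le> (\<tau> + 1) * (v\<^sup>2 * exp (- v\<^sup>2 / 4)))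
      sequentially"
proof -
  show K: "eventually (\<lambda>n. \<forall>v. \<bar>weight_K n v\<bar> \<le> exp (- v\<^sup>2 / 4)) sequentially"
    using eventually_K_large
  proof eventually_elim
    case (elim n)
    then show ?case
      using scaled_weight_le_gauss[of "real (P n)" "K n - 3"] P_pos[of n]
      by (auto simp: weight_K_def scaled_weight_nonneg abs_of_nonneg)
  qed
  show "eventually (\<lambda>n. \<forall>v. \<bar>weight_P n v\<bar> \<le> exp (- v\<^sup>2 / 4)) sequentially"
    using eventually_K_large
  proof eventually_elim
    case (elim n)
    then have "real (P n) \<le> 2 * real (P n - 3)" using K_le_P[of n] by linarith
    then show ?case
      using elim scaled_weight_le_gauss[of "real (P n)" "P n - 3"] P_pos[of n]
      by (simp add: weight_P_def scaled_weight_nonneg)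
  qed
  \<comment> \<open>Any constant above the limit \<open>\<tau>\<close> would serve; it bounds the
    coefficient of \<open>v\<^sup>2\<close> in the estimate for one minus the extra factor.\<close>
  have "eventually (\<lambda>n. real n * (real (P n - K n) / real (P n)) < \<tau> + 1) sequentially"
    by (rule order_tendstoD(2)[OF codim_alt]) simp
  then show "eventually (\<lambda>n. \<forall>v. \<bar>real n * (weight_K n v - weight_P n v)\<bar> \<le>
      (\<tau> + 1) * (v\<^sup>2 * exp (- v\<^sup>2 / 4))) sequentially"
    using K eventually_diff_eq eventually_ge_at_top[of 1]
  proof eventually_elim
    case (elim n)
    show ?case
    proof
      fix v
      let ?d = "1 - scaled_weight (real (P n)) (P n - K n) v"
      have d: "0 \<le> ?d" "?d \<le> real (P n - K n) * v\<^sup>2 / real (P n)"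
        using one_minus_scaled_weight[of "real (P n)" "P n - K n" v] P_pos[of n] elim by auto
      have "real n * ?d \<le> real n * (real (P n - K n) * v\<^sup>2 / real (P n))"
        using d(2) by (rule mult_left_mono) simp
      also have "\<dots> = real n * (real (P n - K n) / real (P n)) * v\<^sup>2" by simp
      also have "\<dots> \<le> (\<tau> + 1) * v\<^sup>2"
        using elim(1) by (intro mult_right_mono) auto
      finally have 1: "real n * ?d \<le> (\<tau> + 1) * v\<^sup>2" .
      have "\<bar>real n * (weight_K n v - weight_P n v)\<bar> = \<bar>weight_K n v\<bar> * (real n * ?d)"
        using elim(3) d(1) by (simp add: abs_mult)
      also have "\<dots> \<le> exp (- v\<^sup>2 / 4) * ((\<tau> + 1) * v\<^sup>2)"
      proof (rule mult_mono)
        show "\<bar>weight_K n v\<bar> \<le> exp (- v\<^sup>2 / 4)" using elim(2) by blast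
      qed (use 1 d(1) in simp_all)
      finally show "\<bar>real n * (weight_K n v - weight_P n v)\<bar> \<le> (\<tau> + 1) * (v\<^sup>2 * exp (- v\<^sup>2 / 4))"
        by (simp add: mult_ac)
    qed
  qed
qed

lemma diff_limit: "(\<lambda>n. real n * (weight_K n v - weight_P n v)) \<longlonglongrightarrow> \<tau> / 2 * (v\<^sup>2 * exp (- v\<^sup>2 / 2))"
proof -
  \<comment> \<open>Chosen so that \<open>exp (- d n)\<close> is the extra factor of exponent
    \<open>P n - K n\<close> once \<open>P n > v\<^sup>2\<close>; then \<open>n * d n\<close> tends
    to \<open>\<tau> / 2 * v\<^sup>2\<close>.\<close>
  define d where "d n = real (P n - K n) / real (P n) / 2 * - (real (P n) * ln (1 - v\<^sup>2 / real (P n)))" for n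
  have "(\<lambda>n. real n * (real (P n - K n) / real (P n)) / 2 * - (real (P n) * ln (1 - v\<^sup>2 / real (P n))))
      \<longlonglongrightarrow> \<tau> / 2 * - (- v\<^sup>2)"
    by (intro tendsto_mult tendsto_divide tendsto_minus tendsto_const codim_alt P_ln_limit) simp
  then have 1: "(\<lambda>n. real n * d n) \<longlonglongrightarrow> \<tau> / 2 * v\<^sup>2"
    unfolding d_def by (simp only: mult.assoc times_divide_eq_right minus_minus times_divide_eq_left)
  have 2: "eventually (\<lambda>n. 0 \<le> d n) sequentially"
    using eventually_P_gt[of "v\<^sup>2"]
  proof eventually_elim
    case (elim n)
    then have "0 < 1 - v\<^sup>2 / real (P n)"
      using order.strict_trans1[OF zero_le_power2[of v] elim] by (simp add: divide_less_eq)
    then have "ln (1 - v\<^sup>2 / real (P n)) \<le> 0"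
      by (subst ln_le_zero_iff) auto
    then show ?case by (simp add: d_def mult_nonneg_nonpos)
  qed
  have "(\<lambda>n. weight_K n v * (real n * (1 - exp (- d n)))) \<longlonglongrightarrow> exp (- v\<^sup>2 / 2) * (\<tau> / 2 * v\<^sup>2)"
    by (intro tendsto_mult weight_K_limit sequence_one_minus_exp_limit 1 2)
  moreover have "eventually (\<lambda>n. weight_K n v * (real n * (1 - exp (- d n))) =
      real n * (weight_K n v - weight_P n v)) sequentially"
    using eventually_diff_eq eventually_P_gt[of "v\<^sup>2"]
    by eventually_elim (simp add: scaled_weight_exp d_def)
  ultimately have "(\<lambda>n. real n * (weight_K n v - weight_P n v)) \<longlonglongrightarrow> exp (- v\<^sup>2 / 2) * (\<tau> / 2 * v\<^sup>2)"
    by (rule Lim_transform_eventually)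
  then show ?thesis by (simp only: mult_ac)
qed

abbreviation mass_K :: "nat \<Rightarrow> real" where "mass_K n \<equiv> \<integral>v. weight_K n v \<partial>lborel"
abbreviation mass_P :: "nat \<Rightarrow> real" where "mass_P n \<equiv> \<integral>v. weight_P n v \<partial>lborel"

lemma integrable_gauss_bounds:
  "integrable lborel (\<lambda>v::real. exp (- v\<^sup>2 / 4))"
  "integrable lborel (\<lambda>v::real. c * (v\<^sup>2 * exp (- v\<^sup>2 / 4)))"
  using integrable_power_gauss[of 0] integrable_power_gauss[of 2] by simp_all

lemma mass_K_limit: "mass_K \<longlonglongrightarrow> sqrt (2 * pi)"
  and integrable_weight_K: "eventually (\<lambda>n. integrable lborel (weight_K n)) sequentially"
  using eventually_dominated_convergence[OF _ _ integrable_gauss_bounds(1)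
      weight_K_limit weight_bounds(1)]
  by (simp_all add: integral_gauss[simplified])

lemma mass_P_limit: "mass_P \<longlonglongrightarrow> sqrt (2 * pi)"
  and integrable_weight_P: "eventually (\<lambda>n. integrable lborel (weight_P n)) sequentially"
  using eventually_dominated_convergence[OF _ _ integrable_gauss_bounds(1)
      weight_P_limit weight_bounds(2)]
  by (simp_all add: integral_gauss[simplified])

text \<open>Integrates the pointwise limit of the weight difference; the second moment of
  \<open>exp (- v\<^sup>2 / 2)\<close> equals its total mass \<open>sqrt (2 * pi)\<close>.\<close>

lemma mass_diff_times_n_limit: "(\<lambda>n. real n * (mass_K n - mass_P n)) \<longlonglongrightarrow> \<tau> / 2 * sqrt (2 * pi)"
proof -
  have "(\<lambda>n. \<integral>v. real n * (weight_K n v - weight_P n v) \<partial>lborel) \<longlonglongrightarrow>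
      (\<integral>v. \<tau> / 2 * (v\<^sup>2 * exp (- v\<^sup>2 / 2)) \<partial>lborel)"
    by (rule eventually_dominated_convergence(1)[OF _ _ integrable_gauss_bounds(2)
        diff_limit weight_bounds(3)]) auto
  moreover have "eventually (\<lambda>n. (\<integral>v. real n * (weight_K n v - weight_P n v) \<partial>lborel) =
      real n * (mass_K n - mass_P n)) sequentially"
    using integrable_weight_K integrable_weight_P by eventually_elim simp
  ultimately have "(\<lambda>n. real n * (mass_K n - mass_P n)) \<longlonglongrightarrow> (\<integral>v. \<tau> / 2 * (v\<^sup>2 * exp (- v\<^sup>2 / 2))
      \<partial>lborel)"
    by (rule Lim_transform_eventually)
  then show ?thesis
    by (simp only: integral_mult_right_zero integral_square_gauss)
qed

section \<open>Normalised densities and convergence in mean\<close>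

definition scaled_diff :: "nat \<Rightarrow> real \<Rightarrow> real" where
  "scaled_diff n v = real n * (weight_K n v / mass_K n - weight_P n v / mass_P n)"

definition limit_diff :: "real \<Rightarrow> real" where
  "limit_diff v = \<tau> / 2 * ((v\<^sup>2 - 1) * std_normal_density v)"

lemma measurable_diffs [measurable]: "scaled_diff n \<in> borel_measurable borel"
    "limit_diff \<in> borel_measurable borel"
  unfolding scaled_diff_def limit_diff_def by measurable

lemma integrable_limit_diff: "integrable lborel limit_diff"
  unfolding limit_diff_def by (intro integrable_mult_right integrable_hermite_gauss)

text \<open>The bound 1 lies below the common limit \<open>sqrt (2 * pi)\<close>. It excludes
  division by zero and lets the divisor \<open>mass_K n\<close> be dropped in upper
  estimates.\<close>

lemma eventually_mass_gt_1: "eventually (\<lambda>n. mass_K n > 1 \<and> mass_P n > 1) sequentially"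
proof -
  have "sqrt 1 < sqrt (2 * pi)" using pi_gt3 by (intro real_sqrt_less_mono) simp
  then have "1 < sqrt (2 * pi)" by simp
  then show ?thesis
    using order_tendstoD(1)[OF mass_K_limit] order_tendstoD(1)[OF mass_P_limit] by (intro
        eventually_conj) auto
qed

text \<open>For nonzero masses this is \<open>n * (1 / mass_P n - 1 / mass_K n)\<close>, the effect
  of the differing normalisations.\<close>

definition mass_diff :: "nat \<Rightarrow> real" where "mass_diff n =
    real n * (mass_K n - mass_P n) / (mass_K n * mass_P n)"

lemma mass_diff_limit: "mass_diff \<longlonglongrightarrow> \<tau> / 2 * sqrt (2 * pi) / (sqrt (2 * pi) * sqrt (2 * pi))"
  unfolding mass_diff_def by (intro tendsto_divide tendsto_mult mass_diff_times_n_limit mass_K_limit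
      mass_P_limit) simp

text \<open>Inserts the mixed term \<open>weight_P n v / mass_K n\<close>, separating the change of
  the weight from that of the normalisation.\<close>

lemma scaled_diff_eq: "eventually (\<lambda>n. \<forall>v. scaled_diff n v = real n * (weight_K n v - weight_P n v)
    / mass_K n - weight_P n v * mass_diff n) sequentially"
  using eventually_mass_gt_1
proof eventually_elim
  case (elim n)
  then have "mass_K n \<noteq> 0" "mass_P n \<noteq> 0" by auto
  then show ?case by (simp add: scaled_diff_def mass_diff_def field_simps)
qed

text \<open>The change of the weight contributes the \<open>v\<^sup>2\<close> in
  \<open>limit_diff\<close>, the change of the normalisation the \<open>- 1\<close>.\<close>

lemma scaled_diff_limit: "(\<lambda>n. scaled_diff n v) \<longlonglongrightarrow> limit_diff v"
proof -
  have "(\<lambda>n. real n * (weight_K n v - weight_P n v) / mass_K n - weight_P n v * mass_diff n) \<longlonglongrightarrow>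
      \<tau> / 2 * (v\<^sup>2 * exp (- v\<^sup>2 / 2)) / sqrt (2 * pi) -
      exp (- v\<^sup>2 / 2) * (\<tau> / 2 * sqrt (2 * pi) / (sqrt (2 * pi) * sqrt (2 * pi)))"
    by (intro tendsto_diff tendsto_divide tendsto_mult diff_limit mass_K_limit weight_P_limit
        mass_diff_limit) simp
  also have "\<tau> / 2 * (v\<^sup>2 * exp (- v\<^sup>2 / 2)) / sqrt (2 * pi) -
      exp (- v\<^sup>2 / 2) * (\<tau> / 2 * sqrt (2 * pi) / (sqrt (2 * pi) * sqrt (2 * pi))) = limit_diff v"
    unfolding limit_diff_def std_normal_density_eq by (simp add: divide_simps) (simp add:
        algebra_simps)
  finally have "(\<lambda>n. real n * (weight_K n v - weight_P n v) / mass_K n - weight_P n v * mass_diff n)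
      \<longlonglongrightarrow> limit_diff v" .
  moreover have "eventually (\<lambda>n. real n * (weight_K n v - weight_P n v) / mass_K n - weight_P n v *
      mass_diff n = scaled_diff n v) sequentially"
    using scaled_diff_eq by eventually_elim simp
  ultimately show ?thesis by (simp add: filterlim_cong)
qed

lemma integrable_scaled_diff: "eventually (\<lambda>n. integrable lborel (scaled_diff n)) sequentially"
  using integrable_weight_K integrable_weight_P unfolding scaled_diff_def
  by eventually_elim (intro integrable_mult_right Bochner_Integration.integrable_diff
      integrable_divide_zero, auto)

lemma scaled_diff_L1_limit: "(\<lambda>n. \<integral>v. \<bar>scaled_diff n v - limit_diff v\<bar> \<partial>lborel) \<longlonglongrightarrow> 0"
proof -
  obtain C where C: "eventually (\<lambda>n. \<bar>mass_diff n\<bar> < C) sequentially"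
    using order_tendstoD(2)[OF tendsto_rabs[OF mass_diff_limit]] by (metis gt_ex)
  \<comment> \<open>Sums the bounds for the two terms of \<open>scaled_diff_eq\<close> and for the
    limit; \<open>C\<close> bounds the convergent sequence \<open>mass_diff\<close>.\<close>
  define w where "w v = (\<tau> + 1) * (v\<^sup>2 * exp (- v\<^sup>2 / 4)) + C * exp (- v\<^sup>2 / 4) + \<bar>limit_diff v\<bar>"
      for v
  have w: "integrable lborel w"
    unfolding w_def
    by (intro Bochner_Integration.integrable_add integrable_gauss_bounds integrable_mult_right
        integrable_abs integrable_limit_diff)
  have bound: "eventually (\<lambda>n. \<forall>v. \<bar>\<bar>scaled_diff n v - limit_diff v\<bar>\<bar> \<le> w v) sequentially"
    using scaled_diff_eq C weight_bounds(2,3) eventually_mass_gt_1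
  proof eventually_elim
    case (elim n)
    show ?case
    proof
      fix v
      have "\<bar>real n * (weight_K n v - weight_P n v) / mass_K n\<bar> \<le>
          \<bar>real n * (weight_K n v - weight_P n v)\<bar>"
        using elim(5) by (simp add: abs_divide divide_le_eq mult_le_cancel_left1)
      also have "\<dots> \<le> (\<tau> + 1) * (v\<^sup>2 * exp (- v\<^sup>2 / 4))" using elim(4) by blast
      finally have 1: "\<bar>real n * (weight_K n v - weight_P n v) / mass_K n\<bar> \<le>
          (\<tau> + 1) * (v\<^sup>2 * exp (- v\<^sup>2 / 4))" .
      have "\<bar>weight_P n v * mass_diff n\<bar> \<le> exp (- v\<^sup>2 / 4) * C"
        unfolding abs_mult using elim(2,3) by (intro mult_mono) auto
      then have 2: "\<bar>weight_P n v * mass_diff n\<bar> \<le> C * exp (- v\<^sup>2 / 4)" by (simp add: mult.commute)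
      have "scaled_diff n v = real n * (weight_K n v - weight_P n v) / mass_K n - weight_P n v *
          mass_diff n" using elim(1) by blast
      then show "\<bar>\<bar>scaled_diff n v - limit_diff v\<bar>\<bar> \<le> w v"
        using 1 2 unfolding w_def by linarith
    qed
  qed
  have lim: "(\<lambda>n. \<bar>scaled_diff n v - limit_diff v\<bar>) \<longlonglongrightarrow> 0" for v
    using tendsto_rabs[OF tendsto_diff[OF scaled_diff_limit[of v] tendsto_const[of "limit_diff v"]]]
        by simp
  show ?thesis
    using eventually_dominated_convergence(1)[OF _ _ w lim bound] by simp
qed

abbreviation cdf_diff :: "nat \<Rightarrow> real \<Rightarrow> real" where
  "cdf_diff n u \<equiv> measure (beta_law (K n - 3)) {..u / sqrt (real (P n))} -
    measure (beta_law (P n - 3)) {..u / sqrt (real (P n))}"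

lemma beta_law_diff:
  "eventually (\<lambda>n. \<forall>u. real n * cdf_diff n u = (\<integral>v. indicator {..u} v * scaled_diff n v \<partial>lborel))
      sequentially"
  using eventually_K_large integrable_weight_K integrable_weight_P
proof eventually_elim
  case (elim n)
  have m: "K n - 3 > 0" "P n - 3 > 0" "real (P n) > 0"
    using elim K_le_P[of n] by auto
  show ?case
  proof
    fix u
    have i: "integrable lborel (\<lambda>v. indicator {..u} v * weight_K n v)"
        "integrable lborel (\<lambda>v. indicator {..u} v * weight_P n v)"
      using integrable_mult_indicator[OF _ elim(2), of "{..u}"] integrable_mult_indicator[OF _
          elim(3), of "{..u}"]
      by simp_all
    have "(\<integral>v. indicator {..u} v * scaled_diff n v \<partial>lborel) =
      (\<integral>v. real n * (indicator {..u} v * weight_K n v / mass_K n - indicator {..u} v *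
          weight_P n v / mass_P n) \<partial>lborel)"
      by (intro Bochner_Integration.integral_cong) (auto simp: scaled_diff_def algebra_simps)
    also have "\<dots> = real n * ((\<integral>v. indicator {..u} v * weight_K n v \<partial>lborel) / mass_K n -
        (\<integral>v. indicator {..u} v * weight_P n v \<partial>lborel) / mass_P n)"
      using i by simp
    finally show "real n * cdf_diff n u = (\<integral>v. indicator {..u} v * scaled_diff n v \<partial>lborel)"
      unfolding measure_beta_law_scaled[OF m(1,3)] measure_beta_law_scaled[OF m(2,3)]
      by (simp add: weight_K_def weight_P_def)
  qed
qed

lemma uniform_limit_beta_law:
  "uniform_limit UNIV
    (\<lambda>n u. real n * cdf_diff n u)
    (\<lambda>u. - \<tau> / 2 * (u * exp (- u\<^sup>2 / 2) / sqrt (2 * pi))) sequentially"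
proof (rule uniform_limitI)
  fix e :: real assume "e > 0"
  have "eventually (\<lambda>n. (\<integral>v. \<bar>scaled_diff n v - limit_diff v\<bar> \<partial>lborel) < e) sequentially"
    using order_tendstoD(2)[OF scaled_diff_L1_limit \<open>e > 0\<close>] .
  then show "\<forall>\<^sub>F n in sequentially. \<forall>u\<in>UNIV.
      dist (real n * cdf_diff n u) (- \<tau> / 2 * (u * exp (- u\<^sup>2 / 2) / sqrt (2 * pi))) < e"
    using beta_law_diff integrable_scaled_diff
  proof eventually_elim
    case (elim n)
    show ?case
    proof
      fix u :: real
      have i: "integrable lborel (\<lambda>v. indicator {..u} v * scaled_diff n v)"
          "integrable lborel (\<lambda>v. indicator {..u} v * limit_diff v)"
        using integrable_mult_indicator[OF _ elim(3), of "{..u}"] integrable_mult_indicator[OF _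
            integrable_limit_diff, of "{..u}"]
        by simp_all
      have "(\<integral>v. indicator {..u} v * limit_diff v \<partial>lborel) = (\<integral>v. \<tau> / 2 * (indicator {..u} v *
          ((v\<^sup>2 - 1) * std_normal_density v)) \<partial>lborel)"
        by (intro Bochner_Integration.integral_cong) (auto simp: limit_diff_def)
      also have "\<dots> = \<tau> / 2 * (- u * std_normal_density u)"
        by (simp only: integral_mult_right_zero integral_hermite_gauss)
      finally have limit_diff: "(\<integral>v. indicator {..u} v * limit_diff v \<partial>lborel) =
          - \<tau> / 2 * (u * exp (- u\<^sup>2 / 2) / sqrt (2 * pi))"
        by (simp add: std_normal_density_eq)
      have "\<bar>(\<integral>v. indicator {..u} v * scaled_diff n v \<partial>lborel) - (\<integral>v. indicator {..u} v *
          limit_diff v \<partial>lborel)\<bar> =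
          \<bar>\<integral>v. indicator {..u} v * scaled_diff n v - indicator {..u} v * limit_diff v \<partial>lborel\<bar>"
        using i by simp
      also have "\<dots> \<le> (\<integral>v. \<bar>indicator {..u} v * scaled_diff n v - indicator {..u} v *
          limit_diff v\<bar> \<partial>lborel)"
        using integral_norm_bound[of lborel "\<lambda>v. indicator {..u} v * scaled_diff n v -
            indicator {..u} v * limit_diff v"] by simp
      \<comment> \<open>Dropping the indicator removes \<open>u\<close> from the bound, so one
        threshold for \<open>n\<close> serves every \<open>u\<close>.\<close>
      also have "\<dots> \<le> (\<integral>v. \<bar>scaled_diff n v - limit_diff v\<bar> \<partial>lborel)"
        using i elim(3) integrable_limit_diff
        by (intro integral_mono integrable_abs Bochner_Integration.integrable_diff) (auto simp:
            indicator_def)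
      also have "\<dots> < e" by (rule elim(1))
      finally show "dist (real n * cdf_diff n u) (- \<tau> / 2 * (u * exp (- u\<^sup>2 / 2) / sqrt (2 * pi))) <
          e"
        using elim(2) unfolding dist_real_def limit_diff[symmetric] by simp
    qed
  qed
qed

end

section \<open>Convergence of the distance\<close>

text \<open>Follows from \<open>u\<^sup>2 \<le> exp (u\<^sup>2 - 1)\<close> by taking square roots;
  equality at \<open>u = 1\<close> makes the bound sharp.\<close>

lemma abs_mult_gauss_le: "\<bar>u * exp (- u\<^sup>2 / 2)\<bar> \<le> exp (- 1 / 2)" for u :: real
proof -
  have "u\<^sup>2 \<le> exp (u\<^sup>2 - 1)" using exp_ge_add_one_self[of "u\<^sup>2 - 1"] by simp
  then have "\<bar>u\<bar> \<le> sqrt (exp (u\<^sup>2 - 1))" by (intro real_le_rsqrt) simp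
  also have "\<dots> = exp ((u\<^sup>2 - 1) / 2)"
    by (intro real_sqrt_unique) (simp_all add: power2_eq_square flip: exp_add)
  finally have "\<bar>u\<bar> * exp (- u\<^sup>2 / 2) \<le> exp ((u\<^sup>2 - 1) / 2) * exp (- u\<^sup>2 / 2)"
    by (rule mult_right_mono) simp
  also have "\<dots> = exp (- 1 / 2)" by (simp add: diff_divide_distrib flip: exp_add)
  finally show ?thesis by (simp add: abs_mult)
qed

text \<open>Uniform convergence bounds every \<open>n * \<bar>D n t\<bar>\<close> by the maximum of
  \<open>\<bar>g\<bar>\<close> plus a small error, and the point corresponding to
  \<open>u = 1\<close> nearly attains that maximum.\<close>

lemma SUP_abs_limit:
  fixes D :: "nat \<Rightarrow> real \<Rightarrow> real" and s :: "nat \<Rightarrow> real"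
  assumes unif: "uniform_limit UNIV (\<lambda>n u. real n * D n (u / s n)) g sequentially"
    and s: "eventually (\<lambda>n. s n \<ge> 1) sequentially"
    and g: "\<And>u. \<bar>g u\<bar> \<le> \<bar>g 1\<bar>"
  shows "(\<lambda>n. real n * (SUP t\<in>{-1..1}. \<bar>D n t\<bar>)) \<longlonglongrightarrow> \<bar>g 1\<bar>"
proof (rule tendstoI)
  fix e :: real assume "e > 0"
  then have "e / 2 > 0" by simp
  from uniform_limitD[OF unif this] s eventually_ge_at_top[of 1]
  show "eventually (\<lambda>n. dist (real n * (SUP t\<in>{-1..1}. \<bar>D n t\<bar>)) \<bar>g 1\<bar> < e) sequentially"
  proof eventually_elim
    case (elim n)
    have near: "\<bar>real n * D n t - g (t * s n)\<bar> < e / 2" for t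
    proof -
      have "t * s n / s n = t" using elim(2) by simp
      then show ?thesis using elim(1)[rule_format, of "t * s n"] by (simp add: dist_real_def)
    qed
    have upper: "\<bar>D n t\<bar> \<le> (\<bar>g 1\<bar> + e / 2) / real n" for t
    proof -
      have "\<bar>real n * D n t\<bar> \<le> \<bar>g 1\<bar> + e / 2" using near[of t] g[of "t * s n"] by linarith
      then show ?thesis using elim(3) by (simp add: abs_mult field_simps)
    qed
    have "(SUP t\<in>{-1..1}. \<bar>D n t\<bar>) \<le> (\<bar>g 1\<bar> + e / 2) / real n"
      using upper by (intro cSUP_least) auto
    then have 1: "real n * (SUP t\<in>{-1..1}. \<bar>D n t\<bar>) \<le> \<bar>g 1\<bar> + e / 2"
      using elim(3) by (simp add: field_simps)
    \<comment> \<open>The witness \<open>1 / s n\<close> corresponds to \<open>u = 1\<close>; it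
      lies in \<open>[-1, 1]\<close> because \<open>s n \<ge> 1\<close>.\<close>
    have t: "1 / s n \<in> {-1..1}" "1 / s n * s n = 1"
      using elim(2) by (auto simp: field_simps)
    have "\<bar>D n (1 / s n)\<bar> \<le> (SUP t\<in>{-1..1}. \<bar>D n t\<bar>)"
      using bdd_aboveI2[of "{-1..1}" "\<lambda>t. \<bar>D n t\<bar>", OF upper] t(1) by (rule cSUP_upper[rotated])
    then have "real n * \<bar>D n (1 / s n)\<bar> \<le> real n * (SUP t\<in>{-1..1}. \<bar>D n t\<bar>)"
      by (rule mult_left_mono) simp
    then have "\<bar>real n * D n (1 / s n)\<bar> \<le> real n * (SUP t\<in>{-1..1}. \<bar>D n t\<bar>)"
      by (simp add: abs_mult)
    moreover have "\<bar>g 1\<bar> - e / 2 \<le> \<bar>real n * D n (1 / s n)\<bar>"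
      using near[of "1 / s n"] unfolding t(2) by linarith
    ultimately show ?case
      using 1 \<open>e > 0\<close> unfolding dist_real_def by linarith
  qed
qed

theorem proposition4:
  fixes p k :: "nat \<Rightarrow> nat" and \<tau> :: real
    and H :: "nat \<Rightarrow> (nat \<Rightarrow> real) set"
    and \<mu> \<mu>\<^sub>0 :: "nat \<Rightarrow> (nat \<Rightarrow> real) measure"
  assumes "\<And>n. n \<ge> 1 \<Longrightarrow> 1 \<le> k n \<and> k n \<le> p n"
    and "filterlim (\<lambda>n. real (p n) / real n) at_top sequentially"
    and "(\<lambda>n. (1 - real (k n) / real (p n)) * real n) \<longlonglongrightarrow> \<tau>"
    and "\<tau> > 0"
    and "\<And>n. n \<ge> 1 \<Longrightarrow> subspace (H n) \<and> H n \<subseteq> coord_space (p n) \<and> dim (H n) = k n"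
    and "\<And>n. n \<ge> 1 \<Longrightarrow> uniform_on_sphere (p n) (H n) (\<mu> n)"
    and "\<And>n. n \<ge> 1 \<Longrightarrow> uniform_on_sphere (p n) (coord_space (p n)) (\<mu>\<^sub>0 n)"
  shows "uniform_limit UNIV
           (\<lambda>n u. real n *
              (\<P>(z in \<mu> n \<Otimes>\<^sub>M \<mu> n. sqrt (real (p n)) * dot (p n) (fst z) (snd z) \<le> u)
               - \<P>(z in \<mu>\<^sub>0 n \<Otimes>\<^sub>M \<mu>\<^sub>0 n. sqrt (real (p n)) * dot (p n) (fst z) (snd z) \<le> u)))
           (\<lambda>u. - \<tau> / 2 * (u * exp (- u\<^sup>2 / 2) / sqrt (2 * pi)))
           sequentially \<and>
         (\<lambda>n. real n * sphere_dist (p n) (\<mu> n) (\<mu>\<^sub>0 n)) \<longlonglongrightarrow> \<tau> / (2 * sqrt (2 * exp 1 * pi))"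
proof -
  interpret dimension_limit p k \<tau>
    by unfold_locales (use assms in auto)
  let ?g = "\<lambda>u. - \<tau> / 2 * (u * exp (- u\<^sup>2 / 2) / sqrt (2 * pi))"
  \<comment> \<open>Kept in the unscaled variable \<open>t\<close>, since both claims concern it:
    the first at \<open>t = u / sqrt p\<close>, the second through the supremum over
    \<open>t\<close>.\<close>
  define D where "D n t = \<P>(z in \<mu> n \<Otimes>\<^sub>M \<mu> n. dot (p n) (fst z) (snd z) \<le> t)
    - \<P>(z in \<mu>\<^sub>0 n \<Otimes>\<^sub>M \<mu>\<^sub>0 n. dot (p n) (fst z) (snd z) \<le> t)" for n t
  have D_eq: "eventually (\<lambda>n. \<forall>t. D n t = measure (beta_law (k n - 3)) {..t} -
      measure (beta_law (p n - 3)) {..t}) sequentially"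
    using eventually_K_large
  proof eventually_elim
    case (elim n)
    interpret U: uniform_sphere "p n" "H n" "\<mu> n"
      using assms(5,6)[of n] elim by unfold_locales auto
    \<comment> \<open>The full sphere is the sphere of the subspace
      \<open>coord_space (p n)\<close>, so the same law applies with \<open>p n\<close> in place of
      \<open>k n\<close>.\<close>
    interpret U0: uniform_sphere "p n" "coord_space (p n)" "\<mu>\<^sub>0 n"
      using assms(7)[of n] elim by unfold_locales (auto simp: subspace_coord_space)
    have "k n \<le> p n" using assms(1)[of n] elim by simp
    then show ?case
      using U.prob_dot_le[of "k n - 3"] U0.prob_dot_le[of "p n - 3"] assms(5)[of n] elim
      by (simp add: D_def dim_coord_space)
  qed
  have unif: "uniform_limit UNIV (\<lambda>n u. real n * D n (u / sqrt (real (p n)))) ?g sequentially"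
    by (rule uniform_limit_cong[THEN iffD1, OF _ _ uniform_limit_beta_law])
      (use D_eq in \<open>auto elim: eventually_mono\<close>)
  have D_scaled: "\<P>(z in \<mu> n \<Otimes>\<^sub>M \<mu> n. sqrt (real (p n)) * dot (p n) (fst z) (snd z) \<le> u)
      - \<P>(z in \<mu>\<^sub>0 n \<Otimes>\<^sub>M \<mu>\<^sub>0 n. sqrt (real (p n)) * dot (p n) (fst z) (snd z) \<le> u) =
          D n (u / sqrt (real (p n)))"
    if "n \<ge> 1" for n u
    using P_pos[OF that] by (simp add: D_def pos_le_divide_eq mult.commute)
  have "uniform_limit UNIV
           (\<lambda>n u. real n *
              (\<P>(z in \<mu> n \<Otimes>\<^sub>M \<mu> n. sqrt (real (p n)) * dot (p n) (fst z) (snd z) \<le> u)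
               - \<P>(z in \<mu>\<^sub>0 n \<Otimes>\<^sub>M \<mu>\<^sub>0 n. sqrt (real (p n)) * dot (p n) (fst z) (snd z) \<le>
                   u)))
           ?g sequentially"
    by (rule uniform_limit_cong[THEN iffD1, OF eventually_mono[OF eventually_ge_at_top[of 1]] _ unif])
      (simp_all add: D_scaled)
  moreover have "(\<lambda>n. real n * sphere_dist (p n) (\<mu> n) (\<mu>\<^sub>0 n)) \<longlonglongrightarrow> \<bar>?g 1\<bar>"
    unfolding sphere_dist_def D_def[symmetric]
  proof (rule SUP_abs_limit[OF unif])
    show "eventually (\<lambda>n. sqrt (real (p n)) \<ge> 1) sequentially"
      using eventually_P_gt[of 1] by eventually_elim simp
    show "\<bar>?g u\<bar> \<le> \<bar>?g 1\<bar>" for u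
    proof -
      have "\<bar>?g u\<bar> = \<tau> / 2 / sqrt (2 * pi) * \<bar>u * exp (- u\<^sup>2 / 2)\<bar>"
        using tau_pos by (simp add: abs_mult)
      also have "\<dots> \<le> \<tau> / 2 / sqrt (2 * pi) * exp (- 1 / 2)"
        using tau_pos by (intro mult_left_mono abs_mult_gauss_le) simp
      also have "\<dots> = \<bar>?g 1\<bar>" using tau_pos by (simp add: abs_mult)
      finally show ?thesis .
    qed
  qed
  moreover have "\<bar>?g 1\<bar> = \<tau> / (2 * sqrt (2 * exp 1 * pi))"
  proof -
    \<comment> \<open>The value \<open>exp (- 1 / 2)\<close> at the maximum becomes the factor
      \<open>exp 1\<close> under the root in the denominator.\<close>
    have "sqrt (exp 1) = exp (1 / 2 :: real)"
      by (intro real_sqrt_unique) (simp_all add: power2_eq_square flip: exp_add)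
    then show ?thesis
      using tau_pos by (simp add: abs_mult real_sqrt_mult exp_minus field_simps)
  qed
  ultimately show ?thesis by simp
qed

end
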